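(* Assume $\sigma$ is surjective and every $(\sigma,\delta)$-conjugacy class of $\mathbb{F}$ is algebraic. Let $\mathbf a=(a_1,\dots,a_r)\in\mathbb{F}^r$ with $r\ge2$. The following are equivalent: (1) $\mathbf a$ is a $(\sigma,\delta)$-multiplicity sequence; (2) whenever $b_1,\dots,b_r\in\mathbb{F}$ satisfy $P_{\mathbf a}=(x-b_r)\cdots(x-b_1)$, we have $b_i=a_i$ for all $i$; (3) $(a_i,a_{i+1})$ is a $(\sigma,\delta)$-multiplicity sequence for $i=1,\dots,r-1$; (4) for each $i=1,\dots,r-1$ there exists $\beta_i\in\mathbb{F}^*$ with $a_{i+1}=a_i^{\beta_i}$ and $\beta_i\notin\{\sigma(\beta)a_i+\delta(\beta)-a_i\beta:\beta\in\mathbb{F}\}$ (equivalently $\beta_i\notin\{(a_i^\beta-a_i)\beta:\beta\in\mathbb{F}^*\}\cup\{0\}$); (5) $x-a_r$ is the only monic skew polynomial of degree $1$ that divides $P_{\mathbf a}$ on the left.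
   Context: Let $\mathbb{F}$ be a division ring, $\sigma$ a ring endomorphism and $\delta$ a $\sigma$-derivation; $\mathbb{F}[x;\sigma,\delta]$ is the skew polynomial ring with $xa=\sigma(a)x+\delta(a)$. For $\mathbf a=(a_1,\dots,a_r)$, $P_{\mathbf a}=(x-a_r)\cdots(x-a_1)$; $\mathbf a$ is a $(\sigma,\delta)$-multiplicity sequence if $a_1$ is the only $b\in\mathbb{F}$ such that $x-b$ divides $P_{\mathbf a}$ on the right. Conjugation: $a^\beta=\sigma(\beta)a\beta^{-1}+\delta(\beta)\beta^{-1}$; the conjugacy class of $a$ is $C^{\sigma,\delta}(a)=\{a^\beta:\beta\in\mathbb{F}^*\}$. A set $S\subseteq\mathbb{F}$ is algebraic if some non-zero skew polynomial is right-divisible by $x-b$ for every $b\in S$. *)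

theory Defs
  imports Main
begin

text \<open>Skew polynomials over a division ring 'a, represented by their (left) coefficient
  functions: p stands for the sum over i of (p i) x^i, with finitely many non-zero
  coefficients.  Multiplication is determined by x a = sigma(a) x + delta(a).\<close>

definition ring_endo :: "('a::division_ring \<Rightarrow> 'a) \<Rightarrow> bool" where
  "ring_endo \<sigma> \<longleftrightarrow> (\<forall>a b. \<sigma> (a + b) = \<sigma> a + \<sigma> b) \<and> (\<forall>a b. \<sigma> (a * b) = \<sigma> a * \<sigma> b) \<and> \<sigma> 1 = 1"

definition sigma_derivation :: "('a::division_ring \<Rightarrow> 'a) \<Rightarrow> ('a \<Rightarrow> 'a) \<Rightarrow> bool" where
  "sigma_derivation \<sigma> \<delta> \<longleftrightarrow> (\<forall>a b. \<delta> (a + b) = \<delta> a + \<delta> b) \<and>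
      (\<forall>a b. \<delta> (a * b) = \<sigma> a * \<delta> b + \<delta> a * b)"

definition spoly :: "(nat \<Rightarrow> 'a::zero) \<Rightarrow> bool" where
  "spoly p \<longleftrightarrow> finite {n. p n \<noteq> 0}"

definition sp_const :: "'a::zero \<Rightarrow> nat \<Rightarrow> 'a" where
  "sp_const c = (\<lambda>n. if n = 0 then c else 0)"

definition sp_lin :: "'a::ring_1 \<Rightarrow> nat \<Rightarrow> 'a" where
  "sp_lin b = (\<lambda>n. if n = 1 then 1 else if n = 0 then - b else 0)"

definition sp_xmul :: "('a::ring_1 \<Rightarrow> 'a) \<Rightarrow> ('a \<Rightarrow> 'a) \<Rightarrow> (nat \<Rightarrow> 'a) \<Rightarrow> nat \<Rightarrow> 'a" where
  "sp_xmul \<sigma> \<delta> q = (\<lambda>n. (if n = 0 then 0 else \<sigma> (q (n - 1))) + \<delta> (q n))"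

definition sp_mult :: "('a::ring_1 \<Rightarrow> 'a) \<Rightarrow> ('a \<Rightarrow> 'a) \<Rightarrow> (nat \<Rightarrow> 'a) \<Rightarrow> (nat \<Rightarrow> 'a) \<Rightarrow> nat \<Rightarrow> 'a" where
  "sp_mult \<sigma> \<delta> p q = (\<lambda>n. \<Sum>i\<in>{i. p i \<noteq> 0}. p i * ((sp_xmul \<sigma> \<delta> ^^ i) q) n)"

definition right_dvd :: "('a::ring_1 \<Rightarrow> 'a) \<Rightarrow> ('a \<Rightarrow> 'a) \<Rightarrow> (nat \<Rightarrow> 'a) \<Rightarrow> (nat \<Rightarrow> 'a) \<Rightarrow> bool" where
  "right_dvd \<sigma> \<delta> d p \<longleftrightarrow> (\<exists>q. spoly q \<and> p = sp_mult \<sigma> \<delta> q d)"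

definition left_dvd :: "('a::ring_1 \<Rightarrow> 'a) \<Rightarrow> ('a \<Rightarrow> 'a) \<Rightarrow> (nat \<Rightarrow> 'a) \<Rightarrow> (nat \<Rightarrow> 'a) \<Rightarrow> bool" where
  "left_dvd \<sigma> \<delta> d p \<longleftrightarrow> (\<exists>q. spoly q \<and> p = sp_mult \<sigma> \<delta> d q)"

definition P_seq :: "('a::ring_1 \<Rightarrow> 'a) \<Rightarrow> ('a \<Rightarrow> 'a) \<Rightarrow> 'a list \<Rightarrow> nat \<Rightarrow> 'a" where
  "P_seq \<sigma> \<delta> as = foldl (\<lambda>P a. sp_mult \<sigma> \<delta> (sp_lin a) P) (sp_const 1) as"

definition mult_seq :: "('a::ring_1 \<Rightarrow> 'a) \<Rightarrow> ('a \<Rightarrow> 'a) \<Rightarrow> 'a list \<Rightarrow> bool" where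
  "mult_seq \<sigma> \<delta> as \<longleftrightarrow> as \<noteq> [] \<and> {b. right_dvd \<sigma> \<delta> (sp_lin b) (P_seq \<sigma> \<delta> as)} = {hd as}"

definition sconj :: "('a::division_ring \<Rightarrow> 'a) \<Rightarrow> ('a \<Rightarrow> 'a) \<Rightarrow> 'a \<Rightarrow> 'a \<Rightarrow> 'a" where
  "sconj \<sigma> \<delta> a \<beta> = \<sigma> \<beta> * a * inverse \<beta> + \<delta> \<beta> * inverse \<beta>"

definition conj_class :: "('a::division_ring \<Rightarrow> 'a) \<Rightarrow> ('a \<Rightarrow> 'a) \<Rightarrow> 'a \<Rightarrow> 'a set" where
  "conj_class \<sigma> \<delta> a = {sconj \<sigma> \<delta> a \<beta> | \<beta>. \<beta> \<noteq> 0}"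

definition algebraic_set :: "('a::ring_1 \<Rightarrow> 'a) \<Rightarrow> ('a \<Rightarrow> 'a) \<Rightarrow> 'a set \<Rightarrow> bool" where
  "algebraic_set \<sigma> \<delta> S \<longleftrightarrow> (\<exists>f. spoly f \<and> f \<noteq> (\<lambda>_. 0) \<and> (\<forall>b\<in>S. right_dvd \<sigma> \<delta> (sp_lin b) f))"

definition monic_deg1 :: "(nat \<Rightarrow> 'a::ring_1) \<Rightarrow> bool" where
  "monic_deg1 p \<longleftrightarrow> p 1 = 1 \<and> (\<forall>n\<ge>2. p n = 0)"

end

theory Submission
  imports Defs
begin

text \<open>
  Let \<open>R\<close> be the skew polynomial ring and \<open>T = tact a\<close> the action of \<open>x\<close> on \<open>R/R(x - a)\<close>, whose
  underlying space is the division ring \<open>F\<close>. Condition (3) says that consecutive factors can never be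
  exchanged, and this propagates from pairs to the whole product, both from the right and from the
  left, so it implies all the other conditions.

  Algebraicity enters through a relation \<open>T ^ n + g = 0\<close> of minimal degree. Dividing it by \<open>T - b\<close>
  on either side shows that \<open>T - b\<close> is surjective when it is injective, so that a pair which does not
  split is conjugate, and that \<open>F / (T - a) F\<close> is at most one-dimensional from both sides over the kernel
  of \<open>T - a\<close>. Hence if \<open>(a, b)\<close> and \<open>(a, c)\<close> do not split and \<open>b \<noteq> c\<close>, then the least common left
  multiple of \<open>x - b\<close> and \<open>x - c\<close> has a right factor \<open>x - e\<close> such that \<open>(a, e)\<close> splits; the mirror
  image holds for left factors. By induction on the length, a sequence containing a splitting
  pair therefore has neither a unique right nor a unique left linear factor.
\<close>

section \<open>Skew polynomials and their evaluation\<close>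

locale skew_polynomials =
  fixes \<sigma> \<delta> :: "'a::division_ring \<Rightarrow> 'a"
  assumes endo: "ring_endo \<sigma>" and deriv: "sigma_derivation \<sigma> \<delta>" and surj: "surj \<sigma>"
begin

lemma sigma_add: "\<sigma> (a + b) = \<sigma> a + \<sigma> b"
  and sigma_mult: "\<sigma> (a * b) = \<sigma> a * \<sigma> b"
  and sigma_1: "\<sigma> 1 = 1"
  and delta_add: "\<delta> (a + b) = \<delta> a + \<delta> b"
  and delta_mult: "\<delta> (a * b) = \<sigma> a * \<delta> b + \<delta> a * b"
  using endo deriv by (auto simp: ring_endo_def sigma_derivation_def)

lemma sigma_0: "\<sigma> 0 = 0"
  using sigma_add[of 0 0] by simp

lemma delta_0: "\<delta> 0 = 0"
  using delta_add[of 0 0] by simp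

lemma delta_1: "\<delta> 1 = 0"
  using delta_mult[of 1 1] by (simp add: sigma_1)

lemma sigma_diff: "\<sigma> (a - b) = \<sigma> a - \<sigma> b"
  using sigma_add[of "a - b" b] by simp

lemma delta_diff: "\<delta> (a - b) = \<delta> a - \<delta> b"
  using delta_add[of "a - b" b] by simp

lemma sigma_minus: "\<sigma> (- a) = - \<sigma> a"
  using sigma_diff[of 0 a] by (simp add: sigma_0)

lemma delta_minus: "\<delta> (- a) = - \<delta> a"
  using delta_diff[of 0 a] by (simp add: delta_0)

lemma sigma_sum: "\<sigma> (sum f A) = (\<Sum>i\<in>A. \<sigma> (f i))"
  by (induction A rule: infinite_finite_induct) (simp_all add: sigma_0 sigma_add)

lemma delta_sum: "\<delta> (sum f A) = (\<Sum>i\<in>A. \<delta> (f i))"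
  by (induction A rule: infinite_finite_induct) (simp_all add: delta_0 delta_add)

lemma sigma_eq_0_iff: "\<sigma> a = 0 \<longleftrightarrow> a = 0"
proof
  assume "\<sigma> a = 0"
  then have "\<sigma> (a * inverse a) = 0" by (simp add: sigma_mult)
  then show "a = 0" by (cases "a = 0") (simp_all add: sigma_1)
qed (simp add: sigma_0)

lemma sigma_inverse: "a \<noteq> 0 \<Longrightarrow> \<sigma> (inverse a) = inverse (\<sigma> a)"
  using sigma_mult[of a "inverse a"] by (simp add: sigma_1 inverse_unique)

lemma sigma_inj: "\<sigma> a = \<sigma> b \<Longrightarrow> a = b"
  using sigma_eq_0_iff[of "a - b"] by (simp add: sigma_diff)

lemma sigma_preimage: obtains y where "\<sigma> y = a"
  using surj by (metis surjD)

text \<open>The action of \<open>x\<close> on the left module \<open>R/R(x - c)\<close>, identified with the division ring.\<close>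

definition tact :: "'a \<Rightarrow> 'a \<Rightarrow> 'a" where
  "tact c v = \<sigma> v * c + \<delta> v"

lemma tact_add: "tact c (v + w) = tact c v + tact c w"
  and tact_diff: "tact c (v - w) = tact c v - tact c w"
  and tact_minus: "tact c (- v) = - tact c v"
  and tact_0: "tact c 0 = 0"
  and tact_1: "tact c 1 = c"
  by (simp_all add: tact_def sigma_add delta_add sigma_diff delta_diff sigma_minus delta_minus
      sigma_0 delta_0 sigma_1 delta_1 algebra_simps)

lemma tact_mult: "tact c (a * v) = \<sigma> a * tact c v + \<delta> a * v"
  by (simp add: tact_def sigma_mult delta_mult algebra_simps)

lemma tact_sum: "tact c (sum f A) = (\<Sum>i\<in>A. tact c (f i))"
  by (induction A rule: infinite_finite_induct) (simp_all add: tact_0 tact_add)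

text \<open>Clears the inverses from conjugation; below, conjugacy is used in the form
  \<open>tact a \<beta> = c * \<beta>\<close>.\<close>

lemma sconj_eq_iff: "\<beta> \<noteq> 0 \<Longrightarrow> c = sconj \<sigma> \<delta> a \<beta> \<longleftrightarrow> tact a \<beta> = c * \<beta>"
proof -
  assume b: "\<beta> \<noteq> 0"
  have "sconj \<sigma> \<delta> a \<beta> = tact a \<beta> * inverse \<beta>"
    by (simp add: sconj_def tact_def algebra_simps)
  then have "sconj \<sigma> \<delta> a \<beta> * \<beta> = tact a \<beta>" using b by (simp add: mult.assoc)
  then show ?thesis using b by (metis mult_right_cancel)
qed

lemma conj_exists: "\<beta> \<noteq> 0 \<Longrightarrow> \<exists>c. tact a \<beta> = c * \<beta>"
  using sconj_eq_iff by blast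

text \<open>For nonzero \<beta>, right multiplication by \<beta> is an isomorphism from
  \<open>R/R(x - c)\<close> to \<open>R/R(x - a)\<close>.\<close>

lemma tact_conj: "tact a \<beta> = c * \<beta> \<Longrightarrow> tact a (w * \<beta>) = tact c w * \<beta>"
  by (subst tact_mult) (simp add: tact_def algebra_simps)

lemma conj_inverse:
  assumes "\<beta> \<noteq> 0" "tact a \<beta> = c * \<beta>"
  shows "tact c (inverse \<beta>) = a * inverse \<beta>"
proof -
  have "tact c (inverse \<beta>) * \<beta> = tact a 1"
    using tact_conj[OF assms(2), of "inverse \<beta>"] assms(1) by simp
  then have "tact c (inverse \<beta>) * \<beta> * inverse \<beta> = a * inverse \<beta>" by (simp add: tact_1)
  then show ?thesis using assms(1) by (simp add: mult.assoc)
qed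

section \<open>Left multiplication by \<open>x - a\<close> and products of linear factors\<close>

definition lin_mult :: "'a \<Rightarrow> (nat \<Rightarrow> 'a) \<Rightarrow> nat \<Rightarrow> 'a" where
  "lin_mult a p = (\<lambda>n. sp_xmul \<sigma> \<delta> p n - a * p n)"

lemma lin_mult_Suc:
  "lin_mult a p (Suc n) = \<sigma> (p n) + \<delta> (p (Suc n)) - a * p (Suc n)"
  by (simp add: lin_mult_def sp_xmul_def)

lemma spoly_bound:
  assumes "spoly p" obtains m where "\<And>i. i \<ge> m \<Longrightarrow> p i = 0"
proof -
  obtain m where "\<forall>i\<in>{n. p n \<noteq> 0}. i < m"
    using assms finite_nat_set_iff_bounded by (auto simp: spoly_def)
  then show thesis by (intro that[of m]) (auto simp: not_less[symmetric])
qed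

lemma spolyI: "(\<And>i. i \<ge> m \<Longrightarrow> p i = 0) \<Longrightarrow> spoly p"
  unfolding spoly_def by (rule finite_subset[of _ "{..<m}"]) (auto simp: not_le[symmetric])

lemma sp_mult_bound:
  assumes "\<And>i. i \<ge> m \<Longrightarrow> p i = 0"
  shows "sp_mult \<sigma> \<delta> p q n = (\<Sum>i<m. p i * ((sp_xmul \<sigma> \<delta> ^^ i) q) n)"
  unfolding sp_mult_def using assms
  by (intro sum.mono_neutral_left) (auto simp: not_le[symmetric])

lemma sp_mult_lin: "sp_mult \<sigma> \<delta> (sp_lin a) p = lin_mult a p"
proof
  fix n
  have "sp_mult \<sigma> \<delta> (sp_lin a) p n = (\<Sum>i<2. sp_lin a i * ((sp_xmul \<sigma> \<delta> ^^ i) p) n)"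
    by (rule sp_mult_bound) (simp add: sp_lin_def)
  then show "sp_mult \<sigma> \<delta> (sp_lin a) p n = lin_mult a p n"
    by (simp add: numeral_2_eq_2 sp_lin_def lin_mult_def)
qed

lemma lin_mult_bound:
  assumes "\<And>i. i \<ge> m \<Longrightarrow> p i = 0" "i \<ge> Suc m"
  shows "lin_mult a p i = 0"
  using assms by (cases i) (simp_all add: lin_mult_Suc sigma_0 delta_0)

lemma spoly_lin_mult: "spoly p \<Longrightarrow> spoly (lin_mult a p)"
  by (erule spoly_bound, rule spolyI, erule lin_mult_bound)

lemma spoly_scale: "spoly p \<Longrightarrow> spoly (\<lambda>n. c * p n)"
  for p :: "nat \<Rightarrow> 'a"
  unfolding spoly_def by (erule rev_finite_subset) auto

lemma spoly_diff:
  fixes p q :: "nat \<Rightarrow> 'a"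
  assumes "spoly p" "spoly q" shows "spoly (\<lambda>n. p n - q n)"
proof -
  obtain k m where "\<And>i. i \<ge> k \<Longrightarrow> p i = 0" "\<And>i. i \<ge> m \<Longrightarrow> q i = 0"
    using assms by (auto elim!: spoly_bound)
  then show ?thesis by (intro spolyI[of "max k m"]) simp
qed

lemma spoly_const: "spoly (sp_const c)"
  by (rule spolyI[of 1]) (simp add: sp_const_def)

lemma xmul_pow_bound:
  assumes "\<And>i. i \<ge> m \<Longrightarrow> p i = 0" "i \<ge> m + k"
  shows "((sp_xmul \<sigma> \<delta> ^^ k) p) i = 0"
  using assms(2)
proof (induction k arbitrary: i)
  case (Suc k)
  then show ?case by (simp add: sp_xmul_def sigma_0 delta_0)
qed (use assms(1) in simp)

lemma spoly_sp_mult: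
  assumes "spoly p" "spoly q" shows "spoly (sp_mult \<sigma> \<delta> p q)"
proof -
  obtain k m where k: "\<And>i. i \<ge> k \<Longrightarrow> p i = 0" and m: "\<And>i. i \<ge> m \<Longrightarrow> q i = 0"
    using assms by (auto elim!: spoly_bound)
  show ?thesis
    by (rule spolyI[of "m + k"], subst sp_mult_bound[OF k])
       (auto intro!: sum.neutral simp: xmul_pow_bound[OF m])
qed

text \<open>Associativity with a linear left factor; iterating it gives \<open>P_seq_append\<close>.
  By the Leibniz rule, the terms in \<open>\<sigma> (p i)\<close>, after an index shift, and those
  in \<open>\<delta> (p i)\<close> combine to \<open>x\<close> applied to the product.\<close>

lemma sp_mult_lin_mult:
  assumes "spoly p"
  shows "sp_mult \<sigma> \<delta> (lin_mult a p) q = lin_mult a (sp_mult \<sigma> \<delta> p q)"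
proof
  fix n
  let ?X = "\<lambda>i. (sp_xmul \<sigma> \<delta> ^^ i) q"
  obtain m where m: "\<And>i. i \<ge> m \<Longrightarrow> p i = 0" using assms spoly_bound by blast
  have "sp_mult \<sigma> \<delta> (lin_mult a p) q n = (\<Sum>i<Suc m. lin_mult a p i * ?X i n)"
    by (rule sp_mult_bound) (rule lin_mult_bound[OF m])
  also have "\<dots> = (\<Sum>i<Suc m. sp_xmul \<sigma> \<delta> p i * ?X i n) - (\<Sum>i<m. a * p i * ?X i n)"
    by (simp add: lin_mult_def sum_subtractf left_diff_distrib m)
  also have "(\<Sum>i<Suc m. sp_xmul \<sigma> \<delta> p i * ?X i n) =
      (\<Sum>i<Suc m. (if i = 0 then 0 else \<sigma> (p (i - 1))) * ?X i n) + (\<Sum>i<m. \<delta> (p i) * ?X i n)"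
    by (simp add: sp_xmul_def sum.distrib distrib_right m delta_0)
  also have "(\<Sum>i<Suc m. (if i = 0 then 0 else \<sigma> (p (i - 1))) * ?X i n)
      = (\<Sum>i<m. \<sigma> (p i) * ?X (Suc i) n)"
    by (subst sum.lessThan_Suc_shift) simp
  also have "(\<Sum>i<m. \<sigma> (p i) * ?X (Suc i) n) + (\<Sum>i<m. \<delta> (p i) * ?X i n)
      = sp_xmul \<sigma> \<delta> (\<lambda>n. \<Sum>i<m. p i * ?X i n) n"
    by (simp add: sp_xmul_def sigma_sum delta_sum sigma_mult delta_mult sum.distrib distrib_left
        add.assoc)
  also have "\<dots> - (\<Sum>i<m. a * p i * ?X i n) = lin_mult a (sp_mult \<sigma> \<delta> p q) n"
    by (simp add: lin_mult_def sp_mult_bound[OF m] sum_distrib_left mult.assoc sp_xmul_def)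
  finally show "sp_mult \<sigma> \<delta> (lin_mult a p) q n = lin_mult a (sp_mult \<sigma> \<delta> p q) n" .
qed

lemma sp_mult_one: "sp_mult \<sigma> \<delta> (sp_const 1) q = q"
proof
  fix n
  have "sp_mult \<sigma> \<delta> (sp_const 1) q n = (\<Sum>i<1. sp_const 1 i * ((sp_xmul \<sigma> \<delta> ^^ i) q) n)"
    by (rule sp_mult_bound) (simp add: sp_const_def)
  then show "sp_mult \<sigma> \<delta> (sp_const 1) q n = q n" by (simp add: sp_const_def)
qed

lemma lin_mult_one: "lin_mult a (sp_const 1) = sp_lin a"
  by (auto simp: fun_eq_iff lin_mult_def sp_xmul_def sp_const_def sp_lin_def sigma_0 sigma_1
      delta_0 delta_1)

lemma P_seq_fold: "P_seq \<sigma> \<delta> as = fold lin_mult as (sp_const 1)"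
  by (simp add: P_seq_def sp_mult_lin foldl_conv_fold)

lemma spoly_fold_lin_mult: "spoly p \<Longrightarrow> spoly (fold lin_mult as p)"
  by (induction as arbitrary: p) (simp_all add: spoly_lin_mult)

lemma sp_mult_fold_lin_mult:
  "spoly p \<Longrightarrow> sp_mult \<sigma> \<delta> (fold lin_mult as p) q = fold lin_mult as (sp_mult \<sigma> \<delta> p q)"
  by (induction as arbitrary: p) (simp_all add: sp_mult_lin_mult spoly_lin_mult)

lemma P_seq_append: "P_seq \<sigma> \<delta> (as @ bs) = sp_mult \<sigma> \<delta> (P_seq \<sigma> \<delta> bs) (P_seq \<sigma> \<delta> as)"
  by (simp add: P_seq_fold sp_mult_fold_lin_mult spoly_const sp_mult_one)

text \<open>\<sigma> is injective, so the leading coefficient survives one degree higher. This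
  yields cancellation and shows that 1 has no linear left factor.\<close>

lemma lin_mult_top:
  assumes "spoly p" "p \<noteq> (\<lambda>_. 0)"
  obtains n where "lin_mult a p (Suc n) \<noteq> 0"
proof -
  define n where "n = Max {i. p i \<noteq> 0}"
  have fin: "finite {i. p i \<noteq> 0}" and ne: "{i. p i \<noteq> 0} \<noteq> {}"
    using assms by (auto simp: spoly_def)
  have "p n \<noteq> 0" using Max_in[OF fin ne] by (simp add: n_def)
  moreover have "p (Suc n) = 0" using Max_ge[OF fin, of "Suc n"] by (auto simp: n_def)
  ultimately show thesis
    by (intro that[of n]) (simp add: lin_mult_Suc sigma_eq_0_iff delta_0)
qed

lemma lin_mult_diff: "lin_mult a (\<lambda>n. p n - q n) = (\<lambda>n. lin_mult a p n - lin_mult a q n)"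
  by (auto simp: fun_eq_iff lin_mult_def sp_xmul_def sigma_diff delta_diff algebra_simps)

lemma lin_mult_cancel:
  assumes "spoly p" "spoly q" "lin_mult a p = lin_mult a q"
  shows "p = q"
proof (rule ccontr)
  assume "p \<noteq> q"
  then have "(\<lambda>n. p n - q n) \<noteq> (\<lambda>_. 0)" by (auto simp: fun_eq_iff)
  from lin_mult_top[OF spoly_diff[OF assms(1,2)] this, of a] show False
    using assms(3) by (simp add: lin_mult_diff)
qed

section \<open>Evaluation as the action on 1 in \<open>R/R(x - c)\<close>, and linear right
  factors\<close>

definition eval_at :: "'a \<Rightarrow> (nat \<Rightarrow> 'a) \<Rightarrow> 'a" where
  "eval_at c p = (\<Sum>i\<in>{i. p i \<noteq> 0}. p i * (tact c ^^ i) 1)"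

lemma eval_at_bound:
  assumes "\<And>i. i \<ge> m \<Longrightarrow> p i = 0"
  shows "eval_at c p = (\<Sum>i<m. p i * (tact c ^^ i) 1)"
  unfolding eval_at_def using assms
  by (intro sum.mono_neutral_left) (auto simp: not_le[symmetric])

lemma eval_at_xmul:
  assumes "spoly p" shows "eval_at c (sp_xmul \<sigma> \<delta> p) = tact c (eval_at c p)"
proof -
  let ?t = "\<lambda>i. (tact c ^^ i) 1"
  obtain m where m: "\<And>i. i \<ge> m \<Longrightarrow> p i = 0" using assms spoly_bound by blast
  have "eval_at c (sp_xmul \<sigma> \<delta> p) = (\<Sum>i<Suc m. sp_xmul \<sigma> \<delta> p i * ?t i)"
    by (rule eval_at_bound) (use m in \<open>simp add: sp_xmul_def sigma_0 delta_0\<close>)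
  also have "\<dots> = (\<Sum>i<Suc m. (if i = 0 then 0 else \<sigma> (p (i - 1))) * ?t i) + (\<Sum>i<m. \<delta> (p i) * ?t i)"
    by (simp add: sp_xmul_def sum.distrib distrib_right m delta_0)
  also have "(\<Sum>i<Suc m. (if i = 0 then 0 else \<sigma> (p (i - 1))) * ?t i)
      = (\<Sum>i<m. \<sigma> (p i) * tact c (?t i))"
    by (subst sum.lessThan_Suc_shift) simp
  also have "\<dots> + (\<Sum>i<m. \<delta> (p i) * ?t i) = tact c (eval_at c p)"
    by (simp add: eval_at_bound[OF m] tact_sum tact_mult sum.distrib)
  finally show ?thesis .
qed

lemma spoly_xmul: "spoly p \<Longrightarrow> spoly (sp_xmul \<sigma> \<delta> p)"
  using spoly_lin_mult[of p 0] by (simp add: lin_mult_def)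

lemma eval_at_lin_mult:
  assumes "spoly p" shows "eval_at c (lin_mult a p) = tact c (eval_at c p) - a * eval_at c p"
proof -
  obtain m where m: "\<And>i. i \<ge> m \<Longrightarrow> p i = 0" using assms spoly_bound by blast
  obtain k where k: "\<And>i. i \<ge> k \<Longrightarrow> sp_xmul \<sigma> \<delta> p i = 0"
    using spoly_xmul[OF assms] spoly_bound by blast
  have "eval_at c (lin_mult a p) = eval_at c (sp_xmul \<sigma> \<delta> p) - a * eval_at c p"
    by (subst (1 2 3) eval_at_bound[of "max m k"])
       (simp_all add: lin_mult_def m k left_diff_distrib sum_subtractf sum_distrib_left mult.assoc)
  then show ?thesis by (simp add: eval_at_xmul[OF assms])
qed

lemma eval_at_fold: "spoly p \<Longrightarrow>
    eval_at c (fold lin_mult as p) = fold (\<lambda>a v. tact c v - a * v) as (eval_at c p)"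
  by (induction as arbitrary: p) (simp_all add: eval_at_lin_mult spoly_lin_mult)

lemma eval_at_one: "eval_at c (sp_const 1) = 1"
  using eval_at_bound[of 1 "sp_const 1"] by (simp add: sp_const_def)

lemma eval_at_P_seq: "eval_at c (P_seq \<sigma> \<delta> as) = fold (\<lambda>a v. tact c v - a * v) as 1"
  by (simp add: P_seq_fold eval_at_fold spoly_const eval_at_one)

lemma eval_at_sp_lin: "eval_at c (sp_lin c) = 0"
  by (simp add: lin_mult_one[symmetric] eval_at_lin_mult spoly_const eval_at_one tact_1)

text \<open>Evaluation is left linear, and each \<open>x^i (x - c)\<close> has value 0, because
  \<open>x - c\<close> does and \<open>x\<close> acts through \<open>tact c\<close>.\<close>

lemma eval_at_mult_lin:
  assumes "spoly q" shows "eval_at c (sp_mult \<sigma> \<delta> q (sp_lin c)) = 0"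
proof -
  let ?X = "\<lambda>i. (sp_xmul \<sigma> \<delta> ^^ i) (sp_lin c)"
  let ?t = "\<lambda>i. (tact c ^^ i) 1"
  obtain m where m: "\<And>i. i \<ge> m \<Longrightarrow> q i = 0" using assms spoly_bound by blast
  \<comment> \<open>The coefficients of \<open>x - c\<close> vanish from index 2 on, so fewer than
    \<open>m\<close> shifts stay below \<open>m + 2\<close>; both sums get fixed ranges and can be
    interchanged.\<close>
  have X: "?X i n = 0" if "i < m" "n \<ge> m + 2" for i n
    by (rule xmul_pow_bound[of 2]) (use that in \<open>simp_all add: sp_lin_def\<close>)
  have sl: "spoly (?X i)" for i
    by (induction i) (simp_all add: spoly_xmul lin_mult_one[symmetric] spoly_lin_mult spoly_const)
  have E: "eval_at c (?X i) = 0" for i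
  proof (induction i)
    case (Suc i)
    then show ?case using eval_at_xmul[OF sl[of i], of c] by (simp add: tact_0)
  qed (simp add: eval_at_sp_lin)
  have "eval_at c (sp_mult \<sigma> \<delta> q (sp_lin c)) =
      (\<Sum>n<m + 2. sp_mult \<sigma> \<delta> q (sp_lin c) n * ?t n)"
    by (rule eval_at_bound) (auto simp: sp_mult_bound[OF m] X intro!: sum.neutral)
  also have "\<dots> = (\<Sum>n<m + 2. \<Sum>i<m. q i * (?X i n * ?t n))"
    by (simp only: sp_mult_bound[OF m] sum_distrib_right mult.assoc)
  also have "\<dots> = (\<Sum>i<m. \<Sum>n<m + 2. q i * (?X i n * ?t n))"
    by (rule sum.swap)
  also have "\<dots> = (\<Sum>i<m. q i * eval_at c (?X i))"
    by (intro sum.cong refl, subst eval_at_bound[of "m + 2"]) (simp_all only: X sum_distrib_left lessThan_iff)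
  finally show ?thesis by (simp add: E)
qed

text \<open>A second right factor \<open>x - c\<close> of \<open>(x - b)(x - a)\<close> exists.\<close>

definition splits :: "'a \<Rightarrow> 'a \<Rightarrow> bool" where
  "splits a b \<longleftrightarrow> (\<exists>c. c \<noteq> a \<and> tact c (c - a) = b * (c - a))"

text \<open>The new outer constant comes from comparing the coefficients of \<open>x\<close> on both
  sides; the hypothesis is then equality of the constant terms.\<close>

lemma lin_mult_swap:
  assumes "tact c (c - a) = b * (c - a)"
  shows "lin_mult b (lin_mult a p) = lin_mult (\<sigma> a + b - \<sigma> c) (lin_mult c p)"
proof
  fix n
  have eq: "\<sigma> c * c + \<delta> c + b * a = \<sigma> a * c + \<delta> a + b * c"
    using assms by (simp add: tact_def sigma_diff delta_diff algebra_simps)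
  have "b * (a * v) - \<delta> a * v = (\<sigma> a + b - \<sigma> c) * (c * v) - \<delta> c * v" for v
  proof -
    have "b * a - \<delta> a = (\<sigma> a + b - \<sigma> c) * c - \<delta> c"
      using eq by (simp add: algebra_simps)
    then have "(b * a - \<delta> a) * v = ((\<sigma> a + b - \<sigma> c) * c - \<delta> c) * v" by simp
    then show ?thesis by (simp only: left_diff_distrib mult.assoc)
  qed
  note eq' = this
  show "lin_mult b (lin_mult a p) n = lin_mult (\<sigma> a + b - \<sigma> c) (lin_mult c p) n"
    using eq'[of "p n"]
    by (cases n) (simp_all add: lin_mult_def sp_xmul_def sigma_diff delta_diff sigma_add delta_add
        sigma_mult delta_mult algebra_simps)
qed

text \<open>For nonzero \<open>v\<close> this is the product formula: once a partial product has the
  value \<open>v\<close> at \<open>c\<close>, the remaining factors act as if evaluated at the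
  conjugate \<open>d\<close> of \<open>c\<close>.\<close>

lemma eval_fold_conj:
  assumes "tact c v = d * v"
  shows "fold (\<lambda>a v. tact c v - a * v) as (w * v) = fold (\<lambda>a v. tact d v - a * v) as w * v"
proof (induction as arbitrary: w)
  case (Cons a as)
  have "tact c (w * v) - a * (w * v) = (tact d w - a * w) * v"
    using tact_conj[OF assms] by (simp add: algebra_simps)
  then show ?case using Cons by simp
qed simp

text \<open>Either \<open>c\<close> is the first root, or \<open>c - a\<close> conjugates it to a root of the remaining product, which
  is then moved to the front by two swaps.\<close>

lemma root_factor:
  assumes "fold (\<lambda>a v. tact c v - a * v) as 1 = 0"
  shows "\<exists>bs. \<forall>p. fold lin_mult as p = fold lin_mult (c # bs) p"
  using assms
proof (induction as arbitrary: c)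
  case (Cons a as)
  show ?case
  proof (cases "c = a")
    case False
    then obtain d where d: "tact c (c - a) = d * (c - a)" using conj_exists[of "c - a" c] by auto
    have "fold (\<lambda>a v. tact c v - a * v) as (1 * (c - a)) = 0"
      using Cons.prems by (simp add: tact_1)
    then have "fold (\<lambda>a v. tact d v - a * v) as 1 = 0"
      using False unfolding eval_fold_conj[OF d] by simp
    then obtain bs where bs: "\<And>p. fold lin_mult as p = fold lin_mult (d # bs) p"
      using Cons.IH by blast
    have "fold lin_mult (a # as) p = fold lin_mult (c # (\<sigma> a + d - \<sigma> c) # bs) p" for p
      by (simp add: bs lin_mult_swap[OF d])
    then show ?thesis by blast
  qed auto
qed simp

lemma right_dvd_iff:
  "right_dvd \<sigma> \<delta> (sp_lin c) (P_seq \<sigma> \<delta> as) \<longleftrightarrow> fold (\<lambda>a v. tact c v - a * v) as 1 = 0"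
proof
  assume "right_dvd \<sigma> \<delta> (sp_lin c) (P_seq \<sigma> \<delta> as)"
  then show "fold (\<lambda>a v. tact c v - a * v) as 1 = 0"
    by (auto simp: right_dvd_def eval_at_P_seq[symmetric] eval_at_mult_lin)
next
  assume "fold (\<lambda>a v. tact c v - a * v) as 1 = 0"
  then obtain bs where "P_seq \<sigma> \<delta> as = P_seq \<sigma> \<delta> ([c] @ bs)"
    using root_factor by (fastforce simp: P_seq_fold)
  then have "P_seq \<sigma> \<delta> as = sp_mult \<sigma> \<delta> (P_seq \<sigma> \<delta> bs) (sp_lin c)"
    by (simp only: P_seq_append) (simp add: P_seq_fold lin_mult_one)
  then show "right_dvd \<sigma> \<delta> (sp_lin c) (P_seq \<sigma> \<delta> as)"
    unfolding right_dvd_def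
    by (intro exI[of _ "P_seq \<sigma> \<delta> bs"]) (simp add: P_seq_fold spoly_const spoly_fold_lin_mult)
qed

lemma mult_seq_iff:
  "mult_seq \<sigma> \<delta> as \<longleftrightarrow> as \<noteq> [] \<and>
     (\<forall>c. fold (\<lambda>a v. tact c v - a * v) as 1 = 0 \<longrightarrow> c = hd as)"
proof (cases as)
  case (Cons a bs)
  have "fold (\<lambda>a v. tact c v - a * v) bs 0 = 0" for c
    by (induction bs) (simp_all add: tact_0)
  then show ?thesis
    unfolding mult_seq_def right_dvd_iff by (auto simp: Cons tact_1)
qed (simp add: mult_seq_def)

lemma mult_seq_pair: "mult_seq \<sigma> \<delta> [a, b] \<longleftrightarrow> \<not> splits a b"
  by (auto simp: mult_seq_iff splits_def tact_1)

section \<open>The kernel and the cokernel of T - a\<close>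

text \<open>The operators by which skew polynomials of degree less than \<open>n\<close> act on
  \<open>R/R(x - a)\<close>.\<close>

primrec ops :: "'a \<Rightarrow> nat \<Rightarrow> ('a \<Rightarrow> 'a) set" where
  "ops a 0 = {\<lambda>_. 0}"
| "ops a (Suc n) = {(\<lambda>v. c * (tact a ^^ n) v + g v) | c g. g \<in> ops a n}"

lemma ops_SucI: "g \<in> ops a n \<Longrightarrow> (\<lambda>v. c * (tact a ^^ n) v + g v) \<in> ops a (Suc n)"
  by auto

lemma ops_lift: "g \<in> ops a n \<Longrightarrow> g \<in> ops a (Suc n)"
  using ops_SucI[of g a n 0] by simp

lemma ops_zero: "(\<lambda>_. 0) \<in> ops a n"
  by (induction n) (use ops_lift in auto)

lemma ops_power: "(\<lambda>v. c * (tact a ^^ n) v) \<in> ops a (Suc n)"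
  using ops_SucI[OF ops_zero, where c = c and n = n and a = a] by simp

lemma ops_add: "g \<in> ops a n \<Longrightarrow> h \<in> ops a n \<Longrightarrow> (\<lambda>v. g v + h v) \<in> ops a n"
proof (induction n arbitrary: g h)
  case (Suc n)
  then obtain c g' d h' where gh: "g = (\<lambda>v. c * (tact a ^^ n) v + g' v)" "g' \<in> ops a n"
    "h = (\<lambda>v. d * (tact a ^^ n) v + h' v)" "h' \<in> ops a n"
    by auto
  have "(\<lambda>v. g v + h v) = (\<lambda>v. (c + d) * (tact a ^^ n) v + (g' v + h' v))"
    by (simp add: gh algebra_simps)
  with ops_SucI[OF Suc.IH[OF gh(2,4)], of "c + d"] show ?case by simp
qed simp

lemma ops_scale: "g \<in> ops a n \<Longrightarrow> (\<lambda>v. d * g v) \<in> ops a n"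
proof (induction n arbitrary: g)
  case (Suc n)
  then obtain c g' where g: "g = (\<lambda>v. c * (tact a ^^ n) v + g' v)" "g' \<in> ops a n"
    by auto
  have "(\<lambda>v. d * g v) = (\<lambda>v. (d * c) * (tact a ^^ n) v + d * g' v)"
    by (simp add: g algebra_simps)
  with ops_SucI[OF Suc.IH[OF g(2)], of "d * c"] show ?case by simp
qed simp

lemma ops_tact: "g \<in> ops a n \<Longrightarrow> (\<lambda>v. tact a (g v)) \<in> ops a (Suc n)"
proof (induction n arbitrary: g)
  case 0
  then show ?case using ops_zero[of a 1] by (simp add: tact_0)
next
  case (Suc n)
  then obtain c g' where g: "g = (\<lambda>v. c * (tact a ^^ n) v + g' v)" "g' \<in> ops a n"
    by auto
  have "(\<lambda>v. \<delta> c * (tact a ^^ n) v + tact a (g' v)) \<in> ops a (Suc n)"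
    by (rule ops_add[OF ops_power Suc.IH[OF g(2)]])
  from ops_SucI[OF this, of "\<sigma> c"] show ?case
    by (simp add: g(1) tact_add tact_mult algebra_simps)
qed

text \<open>Reflects \<open>x^n b = \<sigma>^n(b) x^n + ...\<close>; right division uses it to bring
  constants back to the left.\<close>

lemma ops_power_const: "(\<lambda>v. (tact a ^^ n) (b * v)) \<in> ops a (Suc n)"
proof (induction n)
  case 0
  show ?case using ops_power[where c = b and a = a and n = 0] by simp
next
  case (Suc n)
  from ops_tact[OF this] show ?case by simp
qed

text \<open>Surjectivity supplies \<open>y\<close> with \<open>\<sigma> y = c\<close>; subtracting
  \<open>(T - b) y T^m\<close> from \<open>c T^(m + 1) + g'\<close> leaves
  \<open>(b y - \<delta> y) T^m + g'\<close>, of lower degree.\<close>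

lemma ops_left_division:
  assumes "g \<in> ops a n"
  obtains h c where "h \<in> ops a (n - 1)" "\<And>v. g v = tact a (h v) - b * h v + c * v"
proof -
  have "\<exists>h c. h \<in> ops a (n - 1) \<and> (\<forall>v. g v = tact a (h v) - b * h v + c * v)"
    using assms
  proof (induction n arbitrary: g)
    case 0
    then show ?case by (auto simp: tact_0 intro!: exI[of _ "0::'a"])
  next
    case (Suc n)
    then obtain c g' where g: "g = (\<lambda>v. c * (tact a ^^ n) v + g' v)" "g' \<in> ops a n"
      by auto
    show ?case
    proof (cases n)
      case 0
      then show ?thesis
        using g by (intro exI[of _ "\<lambda>_. 0"] exI[of _ c]) (simp add: tact_0)
    next
      case (Suc m)
      obtain y where y: "\<sigma> y = c" by (rule sigma_preimage)
      have "(\<lambda>v. (b * y - \<delta> y) * (tact a ^^ m) v + g' v) \<in> ops a n"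
        using g(2) ops_add[OF ops_power] by (simp add: Suc del: ops.simps)
      from Suc.IH[OF this] obtain h d where h: "h \<in> ops a m"
        "\<And>v. (b * y - \<delta> y) * (tact a ^^ m) v + g' v = tact a (h v) - b * h v + d * v"
        by (auto simp: Suc)
      show ?thesis
      proof (intro exI conjI allI)
        show "(\<lambda>v. y * (tact a ^^ m) v + h v) \<in> ops a (Suc n - 1)"
          using h(1) ops_SucI by (simp add: Suc del: ops.simps)
        fix v
        show "g v = tact a (y * (tact a ^^ m) v + h v) - b * (y * (tact a ^^ m) v + h v) + d * v"
          using h(2)[of v] by (simp add: g(1) Suc tact_add tact_mult y algebra_simps)
      qed
    qed
  qed
  then show thesis using that by blast
qed

text \<open>The leading term is cancelled by \<open>c T^m (T - b)\<close>; the correction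
  \<open>c T^m b\<close> must be rewritten with left coefficients before the induction
  applies.\<close>

lemma ops_right_division:
  assumes "g \<in> ops a n"
  obtains h c where "h \<in> ops a (n - 1)" "\<And>v. g v = h (tact a v - b * v) + c * v"
proof -
  have "\<exists>h c. h \<in> ops a (n - 1) \<and> (\<forall>v. g v = h (tact a v - b * v) + c * v)"
    using assms
  proof (induction n arbitrary: g)
    case 0
    then show ?case by (auto intro!: exI[of _ "0::'a"])
  next
    case (Suc n)
    then obtain c g' where g: "g = (\<lambda>v. c * (tact a ^^ n) v + g' v)" "g' \<in> ops a n"
      by auto
    show ?case
    proof (cases n)
      case 0
      then show ?thesis
        using g by (intro exI[of _ "\<lambda>_. 0"] exI[of _ c]) simp
    next
      case (Suc m)
      have diff: "(tact a ^^ k) (v - w) = (tact a ^^ k) v - (tact a ^^ k) w" for k v w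
        by (induction k arbitrary: v w) (simp_all add: tact_diff)
      have "(\<lambda>v. c * (tact a ^^ m) (b * v) + g' v) \<in> ops a n"
        using g(2) ops_add[OF ops_scale[OF ops_power_const]] by (simp add: Suc del: ops.simps)
      from Suc.IH[OF this] obtain h d where h: "h \<in> ops a m"
        "\<And>v. c * (tact a ^^ m) (b * v) + g' v = h (tact a v - b * v) + d * v"
        by (auto simp: Suc)
      show ?thesis
      proof (intro exI conjI allI)
        show "(\<lambda>v. c * (tact a ^^ m) v + h v) \<in> ops a (Suc n - 1)"
          using h(1) ops_SucI by (simp add: Suc del: ops.simps)
        fix v
        show "g v = c * (tact a ^^ m) (tact a v - b * v) + h (tact a v - b * v) + d * v"
          using h(2)[of v]
          by (simp add: g(1) Suc diff funpow_swap1 right_diff_distrib) (simp add: algebra_simps)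
      qed
    qed
  qed
  then show thesis using that by blast
qed

lemma power_tact_conj:
  assumes "tact a \<beta> = c * \<beta>"
  shows "(tact c ^^ i) 1 * \<beta> = (tact a ^^ i) \<beta>"
proof (induction i)
  case (Suc i)
  then show ?case using tact_conj[OF assms, of "(tact c ^^ i) 1"] by simp
qed simp

text \<open>If \<open>f\<close> vanishes on the class of \<open>a\<close>, then \<open>f(T)\<close>
  kills every \<open>v\<close>: for nonzero \<open>v\<close>, \<open>f(T) v\<close> is the value of
  \<open>f\<close> at the conjugate of \<open>a\<close> by \<open>v\<close>, times \<open>v\<close>.
  Dividing by the leading coefficient makes the relation monic.\<close>

lemma algebraic_relation:
  assumes "algebraic_set \<sigma> \<delta> (conj_class \<sigma> \<delta> a)"
  obtains n g where "g \<in> ops a n" "\<And>v. (tact a ^^ n) v + g v = 0"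
proof -
  obtain f where f: "spoly f" "f \<noteq> (\<lambda>_. 0)"
    "\<And>b. b \<in> conj_class \<sigma> \<delta> a \<Longrightarrow> right_dvd \<sigma> \<delta> (sp_lin b) f"
    using assms by (auto simp: algebraic_set_def)
  define n where "n = Max {i. f i \<noteq> 0}"
  have fin: "finite {i. f i \<noteq> 0}" and ne: "{i. f i \<noteq> 0} \<noteq> {}"
    using f by (auto simp: spoly_def)
  have fn: "f n \<noteq> 0" using Max_in[OF fin ne] by (simp add: n_def)
  have bound: "f i = 0" if "i \<ge> Suc n" for i
    using Max_ge[OF fin, of i] that by (auto simp: n_def)
  have ops_sum: "(\<lambda>v. \<Sum>i<k. f i * (tact a ^^ i) v) \<in> ops a k" for k
  proof (induction k)
    case (Suc k)
    from ops_SucI[OF this, of "f k"] show ?case by (simp add: add.commute del: ops.simps)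
  qed simp
  have zero: "(\<Sum>i<Suc n. f i * (tact a ^^ i) v) = 0" for v
  proof (cases "v = 0")
    case True
    have "(tact a ^^ i) 0 = 0" for i by (induction i) (simp_all add: tact_0)
    with True show ?thesis by simp
  next
    case False
    define c where "c = sconj \<sigma> \<delta> a v"
    have c: "tact a v = c * v" using sconj_eq_iff[OF False, of c a] c_def by simp
    have "c \<in> conj_class \<sigma> \<delta> a" using False by (auto simp: conj_class_def c_def)
    from f(3)[OF this] have "eval_at c f = 0" by (auto simp: right_dvd_def eval_at_mult_lin)
    then have "(\<Sum>i<Suc n. f i * (tact c ^^ i) 1) * v = 0"
      using eval_at_bound[OF bound] by simp
    then show ?thesis by (simp only: sum_distrib_right mult.assoc power_tact_conj[OF c])
  qed
  show thesis
  proof (rule that)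
    show "(\<lambda>v. inverse (f n) * (\<Sum>i<n. f i * (tact a ^^ i) v)) \<in> ops a n"
      by (rule ops_scale[OF ops_sum])
    fix v
    have "inverse (f n) * (\<Sum>i<Suc n. f i * (tact a ^^ i) v) = 0" by (simp only: zero mult_zero_right)
    then show "(tact a ^^ n) v + inverse (f n) * (\<Sum>i<n. f i * (tact a ^^ i) v) = 0"
      using fn by (simp add: distrib_left mult.assoc[symmetric] add.commute)
  qed
qed

section \<open>Minimal relations and annihilators\<close>

lemma minimal_relation:
  assumes "algebraic_set \<sigma> \<delta> (conj_class \<sigma> \<delta> a)"
  obtains n g where "g \<in> ops a (Suc n)" "\<And>v. (tact a ^^ Suc n) v + g v = 0"
    "\<And>h. h \<in> ops a n \<Longrightarrow> \<exists>v. (tact a ^^ n) v + h v \<noteq> 0"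
proof -
  define P where "P n \<longleftrightarrow> (\<exists>g\<in>ops a n. \<forall>v. (tact a ^^ n) v + g v = 0)" for n
  have "\<exists>n. P n" by (rule algebraic_relation[OF assms]) (auto simp: P_def)
  \<comment> \<open>In degree 0 the relation reads \<open>v = 0\<close>, which fails at
    \<open>v = 1\<close>.\<close>
  moreover have "\<not> P 0" by (auto simp: P_def intro!: exI[of _ 1])
  ultimately obtain n where "P (Suc n)" "\<not> P n"
    using ex_least_nat_less[of P] by blast
  then show thesis using that unfolding P_def by blast
qed

text \<open>Write the minimal relation as \<open>(T - b) T^n + (b T^n + g) = 0\<close>. Dividing
  only the second summand gives \<open>(T - b) q + c = 0\<close> with \<open>q = T^n + h\<close>,
  where \<open>h\<close> has degree below \<open>n\<close>; minimality makes \<open>q\<close>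
  nonzero.\<close>

lemma left_annihilator:
  assumes "algebraic_set \<sigma> \<delta> (conj_class \<sigma> \<delta> a)"
  obtains n q c w where "q \<in> ops a n" "q w \<noteq> 0" "\<And>v. tact a (q v) - b * q v + c * v = 0"
proof -
  obtain n g where g: "g \<in> ops a (Suc n)" "\<And>v. (tact a ^^ Suc n) v + g v = 0"
    "\<And>h. h \<in> ops a n \<Longrightarrow> \<exists>v. (tact a ^^ n) v + h v \<noteq> 0"
    by (rule minimal_relation[OF assms]) blast
  have "(\<lambda>v. b * (tact a ^^ n) v + g v) \<in> ops a (Suc n)"
    by (rule ops_add[OF ops_power g(1)])
  then obtain h c where h: "h \<in> ops a n"
      "\<And>v. b * (tact a ^^ n) v + g v = tact a (h v) - b * h v + c * v"
    by (rule ops_left_division[where b = b]) auto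
  obtain w where w: "(tact a ^^ n) w + h w \<noteq> 0" using g(3)[OF h(1)] by blast
  show thesis
  proof (rule that)
    show "(\<lambda>v. (tact a ^^ n) v + h v) \<in> ops a (Suc n)"
      using ops_SucI[OF h(1), of 1] by (simp del: ops.simps)
    show "(tact a ^^ n) w + h w \<noteq> 0" by (rule w)
    fix v
    show "tact a ((tact a ^^ n) v + h v) - b * ((tact a ^^ n) v + h v) + c * v = 0"
    proof -
      have "g v = - tact a ((tact a ^^ n) v)"
        using g(2)[of v] by (simp add: eq_neg_iff_add_eq_0 add.commute)
      then show ?thesis using h(2)[of v] by (simp add: tact_add algebra_simps)
    qed
  qed
qed

text \<open>The same division on the other side, with the constant \<open>a\<close>. The remainder
  vanishes because 1 lies in the kernel of \<open>T - a\<close>.\<close>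

lemma right_annihilator:
  assumes "algebraic_set \<sigma> \<delta> (conj_class \<sigma> \<delta> a)"
  obtains n q w where "q \<in> ops a n" "q w \<noteq> 0" "\<And>v. q (tact a v - a * v) = 0"
proof -
  obtain n g where g: "g \<in> ops a (Suc n)" "\<And>v. (tact a ^^ Suc n) v + g v = 0"
    "\<And>h. h \<in> ops a n \<Longrightarrow> \<exists>v. (tact a ^^ n) v + h v \<noteq> 0"
    by (rule minimal_relation[OF assms]) blast
  have "(\<lambda>v. (tact a ^^ n) (a * v) + g v) \<in> ops a (Suc n)"
    by (rule ops_add[OF ops_power_const g(1)])
  then obtain h c where h: "h \<in> ops a n"
      "\<And>v. (tact a ^^ n) (a * v) + g v = h (tact a v - a * v) + c * v"
    by (rule ops_right_division[where b = a]) auto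
  have diff: "(tact a ^^ k) (v - w) = (tact a ^^ k) v - (tact a ^^ k) w" for k v w
    by (induction k arbitrary: v w) (simp_all add: tact_diff)
  define q where "q v = (tact a ^^ n) v + h v" for v
  have q: "q (tact a v - a * v) + c * v = 0" for v
  proof -
    have "g v = - (tact a ^^ n) (tact a v)"
      using g(2)[of v] by (simp add: funpow_swap1 eq_neg_iff_add_eq_0 add.commute)
    then show ?thesis using h(2)[of v] by (simp add: q_def diff algebra_simps)
  qed
  have q_ops: "q \<in> ops a (Suc n)"
    using ops_SucI[OF h(1), of 1] by (simp add: q_def[abs_def] del: ops.simps)
  have "q 0 = 0"
  proof -
    have "g 0 = 0" if "g \<in> ops a k" for g k
      using that
    proof (induction k arbitrary: g)
      case (Suc k)
      moreover have "(tact a ^^ k) 0 = 0" by (induction k) (simp_all add: tact_0)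
      ultimately show ?case by auto
    qed auto
    then show ?thesis using q_ops by blast
  qed
  then have "c = 0" using q[of 1] by (simp add: tact_1)
  obtain w where "(tact a ^^ n) w + h w \<noteq> 0" using g(3)[OF h(1)] by blast
  then show thesis using that[OF q_ops, of w] q \<open>c = 0\<close> by (simp add: q_def)
qed

text \<open>The annihilator gives \<open>(T - b) q = - c\<close>. If \<open>c = 0\<close>, a nonzero
  value of \<open>q\<close> would be a kernel vector; otherwise rescaling the argument of
  \<open>q\<close> gives preimages.\<close>

lemma tact_injective_surjective:
  assumes "algebraic_set \<sigma> \<delta> (conj_class \<sigma> \<delta> a)"
    and "\<And>v. tact a v = b * v \<Longrightarrow> v = 0"
  shows "\<exists>w. tact a w - b * w = v"
proof -
  obtain n q c w where q: "q \<in> ops a n" "q w \<noteq> 0" "\<And>v. tact a (q v) - b * q v + c * v = 0"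
    by (rule left_annihilator[OF assms(1), where b = b]) blast
  have "c \<noteq> 0"
  proof
    assume "c = 0"
    then have "tact a (q w) = b * q w" using q(3)[of w] by simp
    then show False using assms(2) q(2) by blast
  qed
  then have "tact a (q (- inverse c * v)) - b * q (- inverse c * v) = v"
    using q(3)[of "- inverse c * v"] by (simp add: mult.assoc[symmetric])
  then show ?thesis by blast
qed

text \<open>\<open>T\<close> is right linear over the kernel \<open>K\<close> of
  \<open>T - a\<close>. Together with the next lemma this makes \<open>K\<close> a division ring,
  the twisted centralizer of \<open>a\<close>.\<close>

lemma centralizer_mult: "tact a s = a * s \<Longrightarrow> tact a (\<beta> * s) = tact a \<beta> * s"
  by (subst tact_mult) (simp add: tact_def algebra_simps)

lemma centralizer_inverse: "k \<noteq> 0 \<Longrightarrow> tact a k = a * k \<Longrightarrow> tact a (inverse k) = a * inverse k"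
  by (rule conj_inverse)

text \<open>The cokernel of \<open>T - a\<close>, like its kernel \<open>K\<close>, is one-dimensional: \<open>q\<close> annihilates \<open>T - a\<close> from
  the right, so its values lie in \<open>K\<close>; dividing \<open>v * q\<close> from the left by \<open>T - a\<close> leaves a
  non-zero constant \<open>u\<close>, and \<open>u * s\<close> agrees with \<open>v * q s\<close> modulo the image of \<open>T - a\<close>.\<close>

lemma cokernel_right_dim_one:
  assumes alg: "algebraic_set \<sigma> \<delta> (conj_class \<sigma> \<delta> a)"
    and \<beta>: "\<beta> \<notin> range (\<lambda>v. tact a v - a * v)"
  obtains s w where "tact a s = a * s" "t = \<beta> * s + (tact a w - a * w)"
proof -
  obtain n q c w where q: "q \<in> ops a n" "q w \<noteq> 0" "\<And>v. tact a (q v) - a * q v + c * v = 0"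
    by (rule left_annihilator[OF alg, where b = a]) blast
  have "c = 0"
  proof (rule ccontr)
    assume "c \<noteq> 0"
    then have "tact a (q (- inverse c * \<beta>)) - a * q (- inverse c * \<beta>) = \<beta>"
      using q(3)[of "- inverse c * \<beta>"] by (simp add: mult.assoc[symmetric])
    from this[symmetric] \<beta> show False by blast
  qed
  then have qK: "tact a (q v) = a * q v" for v using q(3)[of v] by simp
  \<comment> \<open>Scaled so that \<open>v * q w = \<beta>\<close>; a zero remainder
    \<open>u\<close> would then put \<beta> into the image.\<close>
  define v where "v = \<beta> * inverse (q w)"
  have "(\<lambda>x. v * q x) \<in> ops a n" by (rule ops_scale[OF q(1)])
  then obtain y u where y: "\<And>x. v * q x = tact a (y x) - a * y x + u * x"
    by (rule ops_left_division[where b = a]) auto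
  have "u \<noteq> 0"
  proof
    assume "u = 0"
    then have "\<beta> = tact a (y w) - a * y w"
      using y[of w] q(2) by (simp add: v_def mult.assoc)
    with \<beta> show False by blast
  qed
  have all: "\<exists>s w. tact a s = a * s \<and> t = v * s + (tact a w - a * w)" for t
  proof (intro exI conjI)
    let ?x = "inverse u * t"
    show "tact a (q ?x) = a * q ?x" by (rule qK)
    show "t = v * q ?x + (tact a (- y ?x) - a * (- y ?x))"
      using y[of ?x] \<open>u \<noteq> 0\<close> by (simp add: tact_minus mult.assoc[symmetric])
  qed
  \<comment> \<open>\<open>v\<close> generates the cokernel over \<open>K\<close> on the right. The
    coordinate \<open>k\<close> of \<beta> is nonzero, so \<beta> can replace \<open>v\<close> as
    generator.\<close>
  obtain k z where k: "tact a k = a * k" "\<beta> = v * k + (tact a z - a * z)" using all by blast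
  have "k \<noteq> 0"
  proof
    assume "k = 0"
    then have "\<beta> = tact a z - a * z" using k(2) by simp
    with \<beta> show False by blast
  qed
  obtain s x where s: "tact a s = a * s" "t = v * s + (tact a x - a * x)" using all by blast
  let ?m = "inverse k * s"
  have m: "tact a ?m = a * ?m"
    using centralizer_mult[OF s(1), of "inverse k"] centralizer_inverse[OF \<open>k \<noteq> 0\<close> k(1)]
    by (simp add: mult.assoc)
  have v: "v = (\<beta> - (tact a z - a * z)) * inverse k"
    using k(2) \<open>k \<noteq> 0\<close> by (simp add: mult.assoc)
  have "t = \<beta> * ?m + (tact a (x - z * ?m) - a * (x - z * ?m))"
    by (simp add: s(2) v tact_diff centralizer_mult[OF m] algebra_simps)
  with m show thesis by (rule that)
qed

text \<open>This is why \<open>K\<close> acts on the cokernel from the left through \<sigma>: the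
  image of \<open>T - a\<close> absorbs the factor \<open>\<sigma> k\<close>.\<close>

lemma sigma_tact_shift:
  "tact a k = a * k \<Longrightarrow> \<sigma> k * (tact a w - a * w) = tact a (k * w) - a * (k * w)"
proof -
  assume k: "tact a k = a * k"
  have "(\<sigma> k * a + \<delta> k) * w = a * k * w" using k by (simp add: tact_def)
  then show ?thesis by (simp add: tact_mult algebra_simps)
qed

text \<open>The mirror image: now \<open>q\<close> annihilates \<open>T - a\<close> from the left, and the constants \<open>c\<close> left by the
  multiples of \<open>q\<close> preserve the image of \<open>T - a\<close>, which forces \<open>c = \<sigma> k\<close> with \<open>k\<close> in \<open>K\<close>.\<close>

lemma cokernel_left_dim_one:
  assumes alg: "algebraic_set \<sigma> \<delta> (conj_class \<sigma> \<delta> a)"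
    and \<beta>: "\<beta> \<notin> range (\<lambda>v. tact a v - a * v)"
  obtains k w where "tact a k = a * k" "t = \<sigma> k * \<beta> + (tact a w - a * w)"
proof -
  obtain n q v where q: "q \<in> ops a n" "q v \<noteq> 0" "\<And>x. q (tact a x - a * x) = 0"
    by (rule right_annihilator[OF alg]) blast
  have all: "\<exists>k w. tact a k = a * k \<and> t = \<sigma> k * v + (tact a w - a * w)" for t
  proof -
    \<comment> \<open>Scaled so that the operator takes the value \<open>t\<close> at
      \<open>v\<close>; on the image of \<open>T - a\<close> it is zero.\<close>
    have "(\<lambda>x. (t * inverse (q v)) * q x) \<in> ops a n" by (rule ops_scale[OF q(1)])
    then obtain y c where y: "\<And>x. (t * inverse (q v)) * q x = tact a (y x) - a * y x + c * x"
      by (rule ops_left_division[where b = a]) auto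
    obtain k where k: "\<sigma> k = c" by (rule sigma_preimage)
    have "tact a k = a * k"
    proof (rule ccontr)
      let ?d = "a * k - tact a k"
      assume "tact a k \<noteq> a * k"
      then have d: "?d \<noteq> 0" by simp
      \<comment> \<open>Chosen with \<open>?d * w = \<beta>\<close>. Both \<open>c * ?n\<close> and
        \<open>c * ?n - \<beta>\<close> then lie in the image: the first because \<open>q\<close>
        kills \<open>?n\<close>, the second by the Leibniz rule.\<close>
      define w where "w = inverse ?d * \<beta>"
      let ?n = "tact a w - a * w"
      have 1: "c * ?n = tact a (- y ?n) - a * (- y ?n)"
        using y[of ?n] q(3)[of w] by (simp add: tact_minus algebra_simps eq_neg_iff_add_eq_0)
      have 2: "c * ?n = tact a (k * w) - a * (k * w) + ?d * w"
        by (simp add: k[symmetric] tact_mult) (simp add: tact_def algebra_simps)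
      have 3: "?d * w = \<beta>" using d by (simp add: w_def mult.assoc[symmetric])
      have "\<beta> = c * ?n - (tact a (k * w) - a * (k * w))" by (simp only: 2 3) simp
      also have "\<dots> = (tact a (- y ?n) - a * (- y ?n)) - (tact a (k * w) - a * (k * w))"
        by (simp only: 1)
      also have "\<dots> = tact a (- y ?n - k * w) - a * (- y ?n - k * w)"
        by (simp add: tact_diff algebra_simps)
      finally have "\<beta> = tact a (- y ?n - k * w) - a * (- y ?n - k * w)" .
      with \<beta> show False by blast
    qed
    moreover have "t = \<sigma> k * v + (tact a (y v) - a * y v)"
      using y[of v] q(2) by (simp add: k mult.assoc)
    ultimately show ?thesis by blast
  qed
  obtain k z where k: "tact a k = a * k" "\<beta> = \<sigma> k * v + (tact a z - a * z)" using all by blast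
  have "k \<noteq> 0"
  proof
    assume "k = 0"
    then have "\<beta> = tact a z - a * z" using k(2) by (simp add: sigma_0)
    with \<beta> show False by blast
  qed
  obtain s x where s: "tact a s = a * s" "t = \<sigma> s * v + (tact a x - a * x)" using all by blast
  let ?m = "s * inverse k"
  have m: "tact a ?m = a * ?m"
    using centralizer_mult[OF centralizer_inverse[OF \<open>k \<noteq> 0\<close> k(1)], of s] s(1)
    by (simp add: mult.assoc)
  have "\<sigma> s = \<sigma> ?m * \<sigma> k" using \<open>k \<noteq> 0\<close> by (simp add: sigma_mult[symmetric] mult.assoc)
  then have "\<sigma> s * v = \<sigma> ?m * (\<beta> - (tact a z - a * z))" by (simp add: k(2) mult.assoc)
  also have "\<dots> = \<sigma> ?m * \<beta> - (tact a (?m * z) - a * (?m * z))"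
    by (simp only: right_diff_distrib[of _ \<beta>] sigma_tact_shift[OF m])
  finally have sv: "\<sigma> s * v = \<sigma> ?m * \<beta> - (tact a (?m * z) - a * (?m * z))" .
  have "t = \<sigma> ?m * \<beta> + (tact a (x - ?m * z) - a * (x - ?m * z))"
    by (simp only: s(2) sv tact_diff) (simp add: algebra_simps)
  with m show thesis by (rule that)
qed

section \<open>Splitting pairs\<close>

text \<open>The witnesses correspond by \<open>\<gamma> = inverse (c - a)\<close>:
  \<open>c - a\<close> conjugates \<open>c\<close> to \<open>b\<close>, so \<gamma> conjugates
  \<open>b\<close> back to \<open>c\<close>, and \<open>(c - a) * \<gamma> = 1\<close>.\<close>

lemma splits_iff: "splits a b \<longleftrightarrow> 1 \<in> range (\<lambda>v. tact b v - a * v)"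
proof
  assume "splits a b"
  then obtain c where c: "c \<noteq> a" "tact c (c - a) = b * (c - a)" by (auto simp: splits_def)
  have "tact b (inverse (c - a)) = c * inverse (c - a)"
    using conj_inverse[OF _ c(2)] c(1) by simp
  then have "tact b (inverse (c - a)) - a * inverse (c - a) = (c - a) * inverse (c - a)"
    by (simp add: left_diff_distrib)
  then have "1 = tact b (inverse (c - a)) - a * inverse (c - a)" using c(1) by simp
  then show "1 \<in> range (\<lambda>v. tact b v - a * v)" by blast
next
  assume "1 \<in> range (\<lambda>v. tact b v - a * v)"
  then obtain \<gamma> where \<gamma>: "tact b \<gamma> - a * \<gamma> = 1" by auto
  then have "\<gamma> \<noteq> 0" by (auto simp: tact_0)
  moreover have "tact b \<gamma> = (a + inverse \<gamma>) * \<gamma>"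
    using \<gamma> \<open>\<gamma> \<noteq> 0\<close> by (simp add: distrib_right diff_eq_eq add.commute)
  ultimately have "tact (a + inverse \<gamma>) (inverse \<gamma>) = b * inverse \<gamma>" by (rule conj_inverse)
  then show "splits a b"
    using \<open>\<gamma> \<noteq> 0\<close> by (auto simp: splits_def intro!: exI[of _ "a + inverse \<gamma>"])
qed

text \<open>Right multiplication by \<beta> turns \<open>tact b - a\<close> into
  \<open>tact a - a\<close> and sends 1 to \<beta>. Splitting thus becomes a question about the
  class of \<beta> in the cokernel.\<close>

lemma splits_conj:
  assumes "\<beta> \<noteq> 0" "tact a \<beta> = b * \<beta>"
  shows "splits a b \<longleftrightarrow> \<beta> \<in> range (\<lambda>v. tact a v - a * v)"
proof -
  have eq: "(tact b v - a * v) * \<beta> = tact a (v * \<beta>) - a * (v * \<beta>)" for v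
    by (simp add: tact_conj[OF assms(2)] algebra_simps)
  have "1 = tact b v - a * v \<longleftrightarrow> \<beta> = tact a (v * \<beta>) - a * (v * \<beta>)" for v
    unfolding eq[symmetric] using mult_right_cancel[OF assms(1), of 1] by simp
  moreover have "(\<exists>v. \<beta> = tact a (v * \<beta>) - a * (v * \<beta>)) \<longleftrightarrow> (\<exists>v. \<beta> = tact a v - a * v)"
  proof
    assume "\<exists>v. \<beta> = tact a v - a * v"
    then obtain v where v: "\<beta> = tact a v - a * v" ..
    then show "\<exists>v. \<beta> = tact a (v * \<beta>) - a * (v * \<beta>)"
      using assms(1) by (intro exI[of _ "v * inverse \<beta>"]) (simp add: mult.assoc)
  qed blast
  ultimately show ?thesis by (simp add: splits_iff image_iff)
qed

text \<open>With \<open>S = tact b\<close>, the Leibniz rule gives \<open>\<sigma> \<gamma> * (S w -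
  b * w) = S (\<gamma> * w) - a * (\<gamma> * w)\<close>, and a suitable \<open>w\<close> makes the
  left side 1.\<close>

lemma splits_conj_left:
  assumes "\<gamma> \<noteq> 0" "tact b \<gamma> = a * \<gamma>"
    and "inverse (\<sigma> \<gamma>) \<in> range (\<lambda>v. tact b v - b * v)"
  shows "splits a b"
proof -
  obtain w where w: "inverse (\<sigma> \<gamma>) = tact b w - b * w" using assms(3) by blast
  have "\<sigma> \<gamma> * (tact b w - b * w) = tact b (\<gamma> * w) - tact b \<gamma> * w"
    by (simp add: tact_mult) (simp add: tact_def algebra_simps)
  then have "1 = tact b (\<gamma> * w) - a * (\<gamma> * w)"
    using assms(1) by (simp add: w[symmetric] assms(2) sigma_eq_0_iff mult.assoc)
  then show ?thesis unfolding splits_iff by blast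
qed

lemma not_splits_conj_left:
  assumes "\<gamma> \<noteq> 0" "tact b \<gamma> = a * \<gamma>" "\<not> splits a b"
  shows "inverse (\<sigma> \<gamma>) \<notin> range (\<lambda>v. tact b v - b * v)"
  using splits_conj_left[OF assms(1,2)] assms(3) by blast

section \<open>Sequences in which no consecutive pair splits\<close>

lemma successively_root:
  assumes "successively (\<lambda>a b. \<not> splits a b) as"
    and "fold (\<lambda>a v. tact c v - a * v) as 1 = 0"
  shows "as \<noteq> [] \<and> c = hd as"
  using assms
proof (induction as arbitrary: c)
  case (Cons a as)
  show ?case
  proof (cases "c = a")
    case False
    then obtain d where d: "tact c (c - a) = d * (c - a)" using conj_exists[of "c - a" c] by auto
    have "fold (\<lambda>a v. tact c v - a * v) as (1 * (c - a)) = 0"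
      using Cons.prems by (simp add: tact_1)
    then have "fold (\<lambda>a v. tact d v - a * v) as 1 = 0"
      using False unfolding eval_fold_conj[OF d] by simp
    \<comment> \<open>By induction the conjugate \<open>d\<close> is the next entry, and then
      \<open>c\<close> witnesses that \<open>a\<close> and that entry split.\<close>
    then have "as \<noteq> [] \<and> d = hd as"
      using Cons by (cases as) simp_all
    moreover have "splits a d" using False d by (auto simp: splits_def)
    ultimately show ?thesis using Cons.prems(1) by (simp add: successively_Cons)
  qed simp
qed simp

text \<open>In the ring, \<open>(x - c) \<gamma> = \<sigma>(\<gamma>) (x - a)\<close>. It does for
  left factors what conjugating roots does for right factors.\<close>

lemma lin_mult_conj:
  assumes "tact a \<gamma> = c * \<gamma>"
  shows "lin_mult c (\<lambda>n. \<gamma> * p n) = (\<lambda>n. \<sigma> \<gamma> * lin_mult a p n)"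
proof
  fix n
  have "(\<sigma> \<gamma> * a + \<delta> \<gamma>) * p n = c * \<gamma> * p n" using assms by (simp add: tact_def)
  then show "lin_mult c (\<lambda>n. \<gamma> * p n) n = \<sigma> \<gamma> * lin_mult a p n"
    by (cases n) (simp_all add: lin_mult_def sp_xmul_def sigma_mult delta_mult algebra_simps)
qed

text \<open>Mirror image of the root argument. If \<open>(x - a) P = (x - e) q\<close> with
  \<open>e\<close> different from \<open>a\<close>, then
  \<open>(x - e)(q - P) = (e - a) P = \<sigma>(y) P\<close>, so \<open>P\<close> has a left factor
  \<open>x - d\<close> with \<open>d\<close> conjugate to \<open>e\<close>. By induction
  \<open>d\<close> is the last entry before \<open>a\<close>, but \<open>d\<close> and
  \<open>a\<close> split.\<close>

lemma successively_left_factor: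
  assumes "successively (\<lambda>a b. \<not> splits a b) as"
    and "spoly q" "P_seq \<sigma> \<delta> as = lin_mult e q"
  shows "as \<noteq> [] \<and> e = last as"
  using assms
proof (induction as arbitrary: e q rule: rev_induct)
  case Nil
  have "q = (\<lambda>_. 0)"
  proof (rule ccontr)
    assume "q \<noteq> (\<lambda>_. 0)"
    then obtain n where "lin_mult e q (Suc n) \<noteq> 0" by (rule lin_mult_top[OF Nil(2)])
    then show False by (simp add: Nil(3)[symmetric] P_seq_fold sp_const_def)
  qed
  with Nil(3) have "sp_const 1 0 = (0 :: 'a)"
    by (simp add: P_seq_fold lin_mult_def sp_xmul_def delta_0)
  then show ?case by (simp add: sp_const_def)
next
  case (snoc a as)
  show ?case
  proof (cases "e = a")
    case False
    let ?P = "P_seq \<sigma> \<delta> as"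
    have P: "spoly ?P" by (simp add: P_seq_fold spoly_fold_lin_mult spoly_const)
    obtain y where y: "\<sigma> y = e - a" by (rule sigma_preimage)
    then have y0: "y \<noteq> 0" using False by (auto simp: sigma_0)
    have "lin_mult a ?P = lin_mult e q" using snoc.prems(3) by (simp add: P_seq_fold)
    then have "lin_mult e (\<lambda>n. q n - ?P n) = (\<lambda>n. \<sigma> y * ?P n)"
      by (simp only: lin_mult_diff y) (simp add: fun_eq_iff lin_mult_def algebra_simps)
    obtain d where d: "tact e (inverse y) = d * inverse y"
      using conj_exists[of "inverse y" e] y0 by auto
    have dy: "tact d y = e * y" using conj_inverse[OF _ d] y0 by simp
    have "lin_mult d (\<lambda>n. inverse y * (q n - ?P n)) =
        (\<lambda>n. \<sigma> (inverse y) * lin_mult e (\<lambda>n. q n - ?P n) n)"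
      by (rule lin_mult_conj[OF d])
    also have "\<dots> = ?P"
      using \<open>lin_mult e _ = _\<close> y0 by (simp add: sigma_inverse sigma_eq_0_iff mult.assoc[symmetric])
    finally have P_eq: "lin_mult d (\<lambda>n. inverse y * (q n - ?P n)) = ?P" .
    have "as \<noteq> [] \<and> d = last as"
    proof (rule snoc.IH)
      show "successively (\<lambda>a b. \<not> splits a b) as"
        using snoc.prems(1) by (simp add: successively_append_iff)
      show "spoly (\<lambda>n. inverse y * (q n - ?P n))"
        by (intro spoly_scale spoly_diff P snoc.prems(2))
    qed (rule P_eq[symmetric])
    moreover have "splits d a"
      unfolding splits_def
    proof (intro exI conjI)
      \<comment> \<open>Since \<open>\<sigma> y = e - a\<close>, replacing \<open>d\<close> by
        \<open>d - y\<close> changes its conjugate by \<open>y\<close> from \<open>e\<close> to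
        \<open>a\<close>.\<close>
      show "d - y \<noteq> d" using y0 by simp
      have "tact (d - y) (- y) = \<sigma> y * y - tact d y"
        by (simp add: tact_def sigma_minus delta_minus algebra_simps)
      also have "\<dots> = a * - y" by (simp add: dy y algebra_simps)
      finally show "tact (d - y) (d - y - d) = a * (d - y - d)" by simp
    qed
    ultimately show ?thesis using snoc.prems(1) by (simp add: successively_append_iff)
  qed simp
qed

lemma not_successively_split:
  assumes "\<not> successively P as"
  obtains xs a b ys where "as = xs @ a # b # ys" "\<not> P a b"
proof -
  have "\<exists>xs a b ys. as = xs @ a # b # ys \<and> \<not> P a b"
    using assms
  proof (induction P as rule: successively.induct)
    case (3 P x y xs)
    show ?case
    proof (cases "P x y")
      case True
      with 3 obtain us a b ys where "y # xs = us @ a # b # ys" "\<not> P a b" by auto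
      then have "x # y # xs = (x # us) @ a # b # ys \<and> \<not> P a b" by simp
      then show ?thesis by blast
    next
      case False
      then show ?thesis by (metis append_Nil)
    qed
  qed simp_all
  then show thesis using that by blast
qed

text \<open>Uniqueness of the left factor fixes the last entry; cancel it and induct.\<close>

lemma successively_unique_factorization:
  assumes "successively (\<lambda>a b. \<not> splits a b) as"
    and "length bs = length as" "P_seq \<sigma> \<delta> bs = P_seq \<sigma> \<delta> as"
  shows "bs = as"
  using assms
proof (induction as arbitrary: bs rule: rev_induct)
  case (snoc a as)
  then obtain cs b where bs: "bs = cs @ [b]" by (cases bs rule: rev_cases) auto
  have sp: "spoly (P_seq \<sigma> \<delta> xs)" for xs
    by (simp add: P_seq_fold spoly_fold_lin_mult spoly_const)
  have eq: "P_seq \<sigma> \<delta> (as @ [a]) = lin_mult b (P_seq \<sigma> \<delta> cs)"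
    using snoc.prems(3) by (simp add: bs P_seq_fold)
  then have "b = a" using successively_left_factor[OF snoc.prems(1) sp] by simp
  then have "lin_mult a (P_seq \<sigma> \<delta> cs) = lin_mult a (P_seq \<sigma> \<delta> as)"
    using eq by (simp add: P_seq_fold)
  then have "P_seq \<sigma> \<delta> cs = P_seq \<sigma> \<delta> as" by (rule lin_mult_cancel[OF sp sp])
  then show ?case using snoc \<open>b = a\<close> by (simp add: bs successively_append_iff)
qed simp

lemma unique_factorization_successively:
  assumes "\<And>bs. length bs = length as \<Longrightarrow> P_seq \<sigma> \<delta> bs = P_seq \<sigma> \<delta> as \<Longrightarrow> bs = as"
  shows "successively (\<lambda>a b. \<not> splits a b) as"
proof (rule ccontr)
  assume "\<not> ?thesis"
  then obtain xs a b ys where as: "as = xs @ a # b # ys" and "splits a b"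
    by (rule not_successively_split) auto
  then obtain c where c: "c \<noteq> a" "tact c (c - a) = b * (c - a)" by (auto simp: splits_def)
  have "P_seq \<sigma> \<delta> (xs @ c # (\<sigma> a + b - \<sigma> c) # ys) = P_seq \<sigma> \<delta> as"
    by (simp add: as P_seq_fold lin_mult_swap[OF c(2)])
  from assms[OF _ this] show False using c(1) by (simp add: as)
qed

text \<open>Later factors send the value 0 to 0, so roots of the prefix are roots of the whole
  product.\<close>

lemma mult_seq_prefix:
  assumes "mult_seq \<sigma> \<delta> (as @ bs)" "as \<noteq> []"
  shows "mult_seq \<sigma> \<delta> as"
proof -
  have "fold (\<lambda>a v. tact c v - a * v) bs 0 = 0" for c
    by (induction bs) (simp_all add: tact_0)
  then show ?thesis using assms by (simp add: mult_seq_iff)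
qed

end

section \<open>Splitting pairs when every conjugacy class is algebraic\<close>

locale algebraic_skew_polynomials = skew_polynomials +
  assumes alg: "\<And>a. algebraic_set \<sigma> \<delta> (conj_class \<sigma> \<delta> a)"
begin

text \<open>If the pair does not split, \<open>tact b - a\<close> misses 1. By algebraicity it then
  has a nonzero kernel vector, whose inverse conjugates \<open>a\<close> to
  \<open>b\<close>.\<close>

lemma not_splits_imp_conj:
  assumes "\<not> splits a b"
  obtains \<beta> where "\<beta> \<noteq> 0" "tact a \<beta> = b * \<beta>"
proof -
  obtain \<gamma> where \<gamma>: "tact b \<gamma> = a * \<gamma>" "\<gamma> \<noteq> 0"
    using tact_injective_surjective[OF alg, of b a 1] assms
    unfolding splits_iff by (auto simp: image_iff eq_commute[of 1])
  show thesis using that[of "inverse \<gamma>"] conj_inverse[OF \<gamma>(2,1)] \<gamma>(2) by simp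
qed

lemma not_splits_iff_conj:
  "\<not> splits a b \<longleftrightarrow>
    (\<exists>\<beta>. \<beta> \<noteq> 0 \<and> b = sconj \<sigma> \<delta> a \<beta> \<and> \<beta> \<notin> {\<sigma> \<gamma> * a + \<delta> \<gamma> - a * \<gamma> | \<gamma>. True})"
proof -
  have range: "{\<sigma> \<gamma> * a + \<delta> \<gamma> - a * \<gamma> | \<gamma>. True} = range (\<lambda>v. tact a v - a * v)"
    by (auto simp: tact_def)
  show ?thesis
  proof
    assume not: "\<not> splits a b"
    then obtain \<beta> where "\<beta> \<noteq> 0" "tact a \<beta> = b * \<beta>" by (rule not_splits_imp_conj)
    with not show "\<exists>\<beta>. \<beta> \<noteq> 0 \<and> b = sconj \<sigma> \<delta> a \<beta> \<and>
        \<beta> \<notin> {\<sigma> \<gamma> * a + \<delta> \<gamma> - a * \<gamma> | \<gamma>. True}"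
      unfolding range by (intro exI[of _ \<beta>]) (simp add: splits_conj sconj_eq_iff)
  next
    assume "\<exists>\<beta>. \<beta> \<noteq> 0 \<and> b = sconj \<sigma> \<delta> a \<beta> \<and>
        \<beta> \<notin> {\<sigma> \<gamma> * a + \<delta> \<gamma> - a * \<gamma> | \<gamma>. True}"
    then obtain \<beta> where "\<beta> \<noteq> 0" "b = sconj \<sigma> \<delta> a \<beta>" "\<beta> \<notin> range (\<lambda>v. tact a v - a * v)"
      unfolding range by blast
    then show "\<not> splits a b" using splits_conj[of \<beta> a b] sconj_eq_iff[of \<beta> b a] by simp
  qed
qed

text \<open>Put \<open>T = tact a\<close>. For nonzero \<open>v\<close>, the conjugate of
  \<open>a\<close> by \<open>v\<close> is a root of \<open>(x - d)(x - b)\<close> iff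
  \<open>v\<close> is in the kernel of \<open>(T - d)(T - b)\<close>. This kernel contains
  \<open>\<beta> * s\<close> and \<gamma>; choosing \<open>s\<close> so that their difference lies
  in the image of \<open>T - a\<close> makes the new root \<open>e\<close> split with
  \<open>a\<close>.\<close>

lemma splitting_right_factor:
  assumes "\<not> splits a b" "\<not> splits a c" "c \<noteq> b" "tact c (c - b) = d * (c - b)"
  obtains e where "splits a e" "tact e (e - b) = d * (e - b)"
proof -
  obtain \<beta> where \<beta>: "\<beta> \<noteq> 0" "tact a \<beta> = b * \<beta>" using not_splits_imp_conj[OF assms(1)] .
  obtain \<gamma> where \<gamma>: "\<gamma> \<noteq> 0" "tact a \<gamma> = c * \<gamma>" using not_splits_imp_conj[OF assms(2)] .
  have "\<beta> \<notin> range (\<lambda>v. tact a v - a * v)" using splits_conj[OF \<beta>] assms(1) by simp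
  then obtain s w where s: "tact a s = a * s" "\<gamma> = \<beta> * s + (tact a w - a * w)"
    by (rule cokernel_right_dim_one[OF alg])
  define \<eta> where "\<eta> = tact a w - a * w"
  have T: "tact a (\<beta> * s) = b * (\<beta> * s)"
    by (simp add: centralizer_mult[OF s(1)] \<beta>(2) mult.assoc)
  have "\<eta> \<noteq> 0"
  proof
    assume "\<eta> = 0"
    then have "\<gamma> = \<beta> * s" using s(2) by (simp add: \<eta>_def)
    then have "c * \<gamma> = b * \<gamma>" using T \<gamma>(2) by (simp only:)
    then show False using \<gamma>(1) assms(3) by simp
  qed
  then obtain e where e: "tact a \<eta> = e * \<eta>" using conj_exists by blast
  have "splits a e" unfolding splits_conj[OF \<open>\<eta> \<noteq> 0\<close> e] by (auto simp: \<eta>_def)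
  moreover have "tact e (e - b) = d * (e - b)"
  proof -
    have \<eta>: "\<eta> = \<gamma> - \<beta> * s" using s(2) by (simp add: \<eta>_def)
    have eq: "(e - b) * \<eta> = (c - b) * \<gamma>"
    proof -
      have "(e - b) * \<eta> = tact a \<eta> - b * \<eta>" by (simp add: e left_diff_distrib)
      also have "\<dots> = (c - b) * \<gamma>" by (simp add: \<eta> tact_diff T \<gamma>(2) algebra_simps)
      finally show ?thesis .
    qed
    have "tact e (e - b) * \<eta> = tact a ((c - b) * \<gamma>)" by (simp add: tact_conj[OF e, symmetric] eq)
    also have "\<dots> = d * ((c - b) * \<gamma>)" by (simp add: tact_conj[OF \<gamma>(2)] assms(4) mult.assoc)
    also have "\<dots> = d * (e - b) * \<eta>" by (simp add: eq[symmetric] mult.assoc)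
    finally show ?thesis using \<open>\<eta> \<noteq> 0\<close> by simp
  qed
  ultimately show thesis by (rule that)
qed

text \<open>Mirror image, with \<open>L\<close> the common product:
  \<open>(x - a) \<gamma> (x - c') = \<sigma>(\<gamma>) L\<close> and
  \<open>(x - a) k \<beta> (x - b') = \<sigma>(k \<beta>) L\<close>. Their difference yields a left
  factor of \<open>L\<close> from \<open>\<eta> = \<gamma> - k \<beta>\<close>, and \<open>k\<close>
  is chosen to put \<open>\<sigma> \<eta>\<close> into the image of
  \<open>tact a - a\<close>.\<close>

lemma splitting_left_factor:
  assumes "\<not> splits b a" "\<not> splits c a" "c \<noteq> b"
    and swap: "\<And>p. lin_mult b (lin_mult b' p) = lin_mult c (lin_mult c' p)"
  obtains e e' where "splits e a" "\<And>p. lin_mult b (lin_mult b' p) = lin_mult e (lin_mult e' p)"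
proof -
  obtain \<beta> where \<beta>: "\<beta> \<noteq> 0" "tact b \<beta> = a * \<beta>" using not_splits_imp_conj[OF assms(1)] .
  obtain \<gamma> where \<gamma>: "\<gamma> \<noteq> 0" "tact c \<gamma> = a * \<gamma>" using not_splits_imp_conj[OF assms(2)] .
  note \<beta>i = conj_inverse[OF \<beta>] and \<gamma>i = conj_inverse[OF \<gamma>]
  have "inverse (\<sigma> (inverse \<beta>)) \<notin> range (\<lambda>v. tact a v - a * v)"
    using not_splits_conj_left[OF _ \<beta>i assms(1)] \<beta>(1) by simp
  then have "\<sigma> \<beta> \<notin> range (\<lambda>v. tact a v - a * v)"
    using \<beta>(1) by (simp add: sigma_inverse)
  then obtain k w where k: "tact a k = a * k" "\<sigma> \<gamma> = \<sigma> k * \<sigma> \<beta> + (tact a w - a * w)"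
    by (rule cokernel_left_dim_one[OF alg])
  define \<eta> where "\<eta> = \<gamma> - k * \<beta>"
  have \<sigma>\<eta>: "\<sigma> \<eta> = tact a w - a * w" using k(2) by (simp add: \<eta>_def sigma_diff sigma_mult)
  have "\<eta> \<noteq> 0"
  proof
    assume "\<eta> = 0"
    then have \<gamma>k: "\<gamma> = k * \<beta>" by (simp add: \<eta>_def)
    then have "tact b \<gamma> = a * \<gamma>" using tact_conj[OF \<beta>(2), of k] k(1) by (simp add: mult.assoc)
    from conj_inverse[OF \<gamma>(1) this] \<gamma>i have "c * inverse \<gamma> = b * inverse \<gamma>" by simp
    then show False using \<gamma>(1) assms(3) by simp
  qed
  then obtain e where e: "tact a (inverse \<eta>) = e * inverse \<eta>"
    using conj_exists[of "inverse \<eta>" a] by auto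
  have e\<eta>: "tact e \<eta> = a * \<eta>" using conj_inverse[OF _ e] \<open>\<eta> \<noteq> 0\<close> by simp
  have "splits e a"
    by (rule splits_conj_left[OF _ e]) (use \<open>\<eta> \<noteq> 0\<close> in \<open>auto simp: sigma_inverse \<sigma>\<eta>\<close>)
  \<comment> \<open>Solves
    \<open>\<eta> (x - e') = \<gamma> (x - c') - k \<beta> (x - b')\<close>.\<close>
  moreover define e' where "e' = inverse \<eta> * (\<gamma> * c' - k * \<beta> * b')"
  have "lin_mult b (lin_mult b' p) = lin_mult e (lin_mult e' p)" for p
  proof -
    let ?L = "lin_mult b (lin_mult b' p)"
    have 1: "lin_mult a (\<lambda>n. \<gamma> * lin_mult c' p n) = (\<lambda>n. \<sigma> \<gamma> * ?L n)"
      unfolding swap by (rule lin_mult_conj[OF \<gamma>(2)])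
    have 2: "lin_mult a (\<lambda>n. k * (\<beta> * lin_mult b' p n)) = (\<lambda>n. \<sigma> k * (\<sigma> \<beta> * ?L n))"
      by (subst lin_mult_conj[OF k(1)], subst lin_mult_conj[OF \<beta>(2)]) simp
    have "\<gamma> * lin_mult c' p n - k * (\<beta> * lin_mult b' p n) = \<eta> * lin_mult e' p n" for n
    proof -
      have "\<eta> * e' = \<gamma> * c' - k * \<beta> * b'"
        using \<open>\<eta> \<noteq> 0\<close> by (simp add: e'_def mult.assoc[symmetric])
      then have "\<eta> * (e' * p n) = (\<gamma> * c' - k * \<beta> * b') * p n" by (simp add: mult.assoc[symmetric])
      then show ?thesis by (simp add: lin_mult_def \<eta>_def algebra_simps)
    qed
    then have "lin_mult a (\<lambda>n. \<eta> * lin_mult e' p n) =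
        lin_mult a (\<lambda>n. \<gamma> * lin_mult c' p n - k * (\<beta> * lin_mult b' p n))" by simp
    also have "\<dots> = (\<lambda>n. \<sigma> \<gamma> * ?L n - \<sigma> k * (\<sigma> \<beta> * ?L n))" by (simp only: lin_mult_diff 1 2)
    also have "\<dots> = (\<lambda>n. \<sigma> \<eta> * ?L n)"
      by (simp add: \<eta>_def sigma_diff sigma_mult algebra_simps)
    finally have "(\<lambda>n. \<sigma> \<eta> * lin_mult e (lin_mult e' p) n) = (\<lambda>n. \<sigma> \<eta> * ?L n)"
      by (simp only: lin_mult_conj[OF e\<eta>])
    then show ?thesis using \<open>\<eta> \<noteq> 0\<close> by (simp add: fun_eq_iff sigma_eq_0_iff)
  qed
  ultimately show thesis by (rule that)
qed

text \<open>By induction on prefixes only the last pair \<open>(b, d)\<close> could split.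
  Exchanging it for any other factorization, with inner root \<open>c\<close>, keeps a multiplicity
  sequence, so by induction \<open>(a, c)\<close> does not split; yet
  \<open>splitting_right_factor\<close> finds such a root that splits with \<open>a\<close>.\<close>

lemma mult_seq_imp_successively:
  "mult_seq \<sigma> \<delta> as \<Longrightarrow> successively (\<lambda>a b. \<not> splits a b) as"
proof (induction "length as" arbitrary: as rule: less_induct)
  case less
  show ?case
  proof (rule ccontr)
    assume not: "\<not> ?thesis"
    then obtain bs d where as1: "as = bs @ [d]" by (cases as rule: rev_cases) auto
    with not obtain cs b where as2: "as = cs @ [b, d]" by (cases bs rule: rev_cases) auto
    have "cs \<noteq> []" using not less.prems by (auto simp: as2 mult_seq_pair)
    then obtain xs a where as: "as = xs @ [a, b, d]" by (cases cs rule: rev_cases) (auto simp: as2)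
    have swapped: "\<not> splits a c" if c: "tact c (c - b) = d * (c - b)" for c
    proof -
      have "P_seq \<sigma> \<delta> (xs @ [a, c, \<sigma> b + d - \<sigma> c]) = P_seq \<sigma> \<delta> as"
        by (simp add: as P_seq_fold lin_mult_swap[OF c])
      then have "mult_seq \<sigma> \<delta> ((xs @ [a, c]) @ [\<sigma> b + d - \<sigma> c])"
        using less.prems by (simp add: mult_seq_def as hd_append)
      then have "mult_seq \<sigma> \<delta> (xs @ [a, c])" by (rule mult_seq_prefix) simp
      from less.hyps[OF _ this] show ?thesis by (simp add: as successively_append_iff)
    qed
    have "mult_seq \<sigma> \<delta> (xs @ [a, b])"
      using less.prems mult_seq_prefix[of "xs @ [a, b]" "[d]"] by (simp add: as)
    from less.hyps[OF _ this] have ab: "successively (\<lambda>a b. \<not> splits a b) (xs @ [a, b])"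
      by (simp add: as)
    with not have "splits b d" by (auto simp: as successively_append_iff)
    then obtain c where c: "c \<noteq> b" "tact c (c - b) = d * (c - b)" by (auto simp: splits_def)
    have "\<not> splits a b" using ab by (simp add: successively_append_iff)
    from splitting_right_factor[OF this swapped[OF c(2)] c] swapped show False by blast
  qed
qed

text \<open>Later entries form the left part of the product, so their left factors persist.\<close>

lemma unique_left_factor_suffix:
  assumes "\<And>e q. spoly q \<Longrightarrow> P_seq \<sigma> \<delta> (as @ bs) = lin_mult e q \<Longrightarrow> e = d"
    and "spoly q" "P_seq \<sigma> \<delta> bs = lin_mult e q"
  shows "e = d"
proof (rule assms(1))
  show "spoly (sp_mult \<sigma> \<delta> q (P_seq \<sigma> \<delta> as))"
    by (intro spoly_sp_mult assms) (simp add: P_seq_fold spoly_fold_lin_mult spoly_const)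
  show "P_seq \<sigma> \<delta> (as @ bs) = lin_mult e (sp_mult \<sigma> \<delta> q (P_seq \<sigma> \<delta> as))"
    by (simp add: P_seq_append assms(3) sp_mult_lin_mult assms(2))
qed

text \<open>Induction from the other end, exchanging the first pair \<open>(b', b)\<close>. In a
  longer list \<open>splitting_left_factor\<close> yields an exchange after which the next pair
  splits; with two entries the exchange itself gives a second left factor.\<close>

lemma unique_left_factor_imp_successively:
  assumes "\<And>e q. spoly q \<Longrightarrow> P_seq \<sigma> \<delta> as = lin_mult e q \<Longrightarrow> e = last as"
  shows "successively (\<lambda>a b. \<not> splits a b) as"
  using assms
proof (induction "length as" arbitrary: as rule: less_induct)
  case less
  show ?case
  proof (rule ccontr)
    assume not: "\<not> ?thesis"
    \<comment> \<open>The case rule distinguishes lists with no, one and at least two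
      entries.\<close>
    then obtain b' b cs where as1: "as = b' # b # cs"
      by (cases as rule: remdups_adj.cases) auto
    \<comment> \<open>The side condition keeps the last entry, and hence the expected left factor,
      unchanged.\<close>
    have suffix: "successively (\<lambda>a b. \<not> splits a b) (e # cs)"
      if e: "\<And>p. lin_mult b (lin_mult b' p) = lin_mult e (lin_mult e' p)"
        and "cs \<noteq> [] \<or> e = b" for e e'
    proof (rule less.hyps)
      show "length (e # cs) < length as" by (simp add: as1)
      have last: "last (e # cs) = last as" using that(2) by (auto simp: as1)
      have P: "P_seq \<sigma> \<delta> ([e'] @ e # cs) = P_seq \<sigma> \<delta> as"
        by (simp add: as1 P_seq_fold e)
      show "x = last (e # cs)" if "spoly q" "P_seq \<sigma> \<delta> (e # cs) = lin_mult x q" for x q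
        unfolding last
        by (rule unique_left_factor_suffix[OF _ that, of "[e']"]) (use less.prems P in simp)
    qed
    have bcs: "successively (\<lambda>a b. \<not> splits a b) (b # cs)" by (rule suffix[of b b']) simp_all
    with not have "splits b' b" by (simp add: as1)
    then obtain c' where c': "c' \<noteq> b'" "tact c' (c' - b') = b * (c' - b')"
      by (auto simp: splits_def)
    define c where "c = \<sigma> b' + b - \<sigma> c'"
    have swap: "lin_mult b (lin_mult b' p) = lin_mult c (lin_mult c' p)" for p
      unfolding c_def by (rule lin_mult_swap[OF c'(2)])
    have "c \<noteq> b" using c'(1) sigma_inj[of b' c'] by (auto simp: c_def)
    show False
    proof (cases cs)
      case Nil
      have "P_seq \<sigma> \<delta> as = lin_mult c (lin_mult c' (sp_const 1))"
        by (simp add: as1 Nil P_seq_fold swap)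
      then have "c = b" using less.prems[of "lin_mult c' (sp_const 1)" c]
        by (simp add: as1 Nil spoly_lin_mult spoly_const)
      with \<open>c \<noteq> b\<close> show False ..
    next
      case (Cons a ds)
      then have "\<not> splits b a" "\<not> splits c a" using bcs suffix[OF swap] by simp_all
      then obtain e e' where "splits e a"
        "\<And>p. lin_mult b (lin_mult b' p) = lin_mult e (lin_mult e' p)"
        by (rule splitting_left_factor[OF _ _ \<open>c \<noteq> b\<close> swap]) blast
      with suffix[of e e'] show False by (simp add: Cons)
    qed
  qed
qed

section \<open>Monic left divisors of degree one\<close>

lemma monic_deg1_iff: "monic_deg1 p \<longleftrightarrow> (\<exists>e. p = sp_lin e)"
proof
  assume p: "monic_deg1 p"
  have "p n = sp_lin (- p 0) n" for n
    using p by (cases "n \<ge> 2") (auto simp: monic_deg1_def sp_lin_def not_le less_2_cases_iff)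
  then show "\<exists>e. p = sp_lin e" by blast
qed (auto simp: monic_deg1_def sp_lin_def)

lemma sp_lin_inj: "sp_lin a = sp_lin b \<Longrightarrow> a = b"
  by (drule fun_cong[where x = 0]) (simp add: sp_lin_def)

lemma unique_left_factor_iff:
  assumes "as \<noteq> []"
  shows "{p. monic_deg1 p \<and> left_dvd \<sigma> \<delta> p (P_seq \<sigma> \<delta> as)} = {sp_lin (last as)} \<longleftrightarrow>
    successively (\<lambda>a b. \<not> splits a b) as"
proof -
  let ?D = "{p. monic_deg1 p \<and> left_dvd \<sigma> \<delta> p (P_seq \<sigma> \<delta> as)}"
  have D: "sp_lin e \<in> ?D \<longleftrightarrow> (\<exists>q. spoly q \<and> P_seq \<sigma> \<delta> as = lin_mult e q)" for e
    by (auto simp: monic_deg1_iff left_dvd_def sp_mult_lin)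
  have "P_seq \<sigma> \<delta> (butlast as @ [last as]) = lin_mult (last as) (P_seq \<sigma> \<delta> (butlast as))"
    by (simp add: P_seq_fold)
  then have last: "sp_lin (last as) \<in> ?D"
    unfolding D using assms
    by (intro exI[of _ "P_seq \<sigma> \<delta> (butlast as)"])
       (simp add: P_seq_fold spoly_fold_lin_mult spoly_const)
  show ?thesis
  proof
    assume eq: "?D = {sp_lin (last as)}"
    show "successively (\<lambda>a b. \<not> splits a b) as"
    proof (rule unique_left_factor_imp_successively)
      fix e q assume "spoly q" "P_seq \<sigma> \<delta> as = lin_mult e q"
      then have "sp_lin e \<in> ?D" unfolding D by blast
      then show "e = last as" unfolding eq by (auto dest: sp_lin_inj)
    qed
  next
    assume S: "successively (\<lambda>a b. \<not> splits a b) as"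
    have "p = sp_lin (last as)" if p: "p \<in> ?D" for p
    proof -
      obtain e where "p = sp_lin e" using p by (auto simp: monic_deg1_iff)
      then show ?thesis using p D[of e] successively_left_factor[OF S] by blast
    qed
    then show "?D = {sp_lin (last as)}" using last by blast
  qed
qed

end

theorem mainTheorem13:
  fixes \<sigma> \<delta> :: "'a::division_ring \<Rightarrow> 'a" and as :: "'a list"
  assumes "ring_endo \<sigma>" and "sigma_derivation \<sigma> \<delta>" and "surj \<sigma>"
    and "\<forall>a. algebraic_set \<sigma> \<delta> (conj_class \<sigma> \<delta> a)"
    and "length as \<ge> 2"
  defines "r \<equiv> length as"
  shows
   "(mult_seq \<sigma> \<delta> as \<longleftrightarrow>
       (\<forall>bs. length bs = r \<and> P_seq \<sigma> \<delta> bs = P_seq \<sigma> \<delta> as \<longrightarrow> bs = as)) \<and>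
    (mult_seq \<sigma> \<delta> as \<longleftrightarrow>
       (\<forall>i < r - 1. mult_seq \<sigma> \<delta> [as ! i, as ! (i + 1)])) \<and>
    (mult_seq \<sigma> \<delta> as \<longleftrightarrow>
       (\<forall>i < r - 1. \<exists>\<beta>. \<beta> \<noteq> 0 \<and> as ! (i + 1) = sconj \<sigma> \<delta> (as ! i) \<beta> \<and>
           \<beta> \<notin> {\<sigma> \<gamma> * (as ! i) + \<delta> \<gamma> - (as ! i) * \<gamma> | \<gamma>. True})) \<and>
    (mult_seq \<sigma> \<delta> as \<longleftrightarrow>
       {p. monic_deg1 p \<and> left_dvd \<sigma> \<delta> p (P_seq \<sigma> \<delta> as)} = {sp_lin (last as)})"
proof -
  interpret algebraic_skew_polynomials \<sigma> \<delta>
    by unfold_locales (use assms in auto)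
  \<comment> \<open>Condition (3) in terms of splitting; each of the five conditions is shown
    equivalent to it.\<close>
  let ?S = "successively (\<lambda>a b. \<not> splits a b) as"
  have "as \<noteq> []" using assms(5) by auto
  have 1: "mult_seq \<sigma> \<delta> as \<longleftrightarrow> ?S"
  proof
    assume ?S
    then show "mult_seq \<sigma> \<delta> as"
      unfolding mult_seq_iff using successively_root \<open>as \<noteq> []\<close> by blast
  qed (rule mult_seq_imp_successively)
  have 2: "(\<forall>bs. length bs = r \<and> P_seq \<sigma> \<delta> bs = P_seq \<sigma> \<delta> as \<longrightarrow> bs = as) \<longleftrightarrow> ?S"
    using successively_unique_factorization unique_factorization_successively
    unfolding r_def by blast
  have pairs: "?S \<longleftrightarrow> (\<forall>i < r - 1. \<not> splits (as ! i) (as ! (i + 1)))"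
    by (auto simp: successively_conv_nth r_def)
  have 3: "(\<forall>i < r - 1. mult_seq \<sigma> \<delta> [as ! i, as ! (i + 1)]) \<longleftrightarrow> ?S"
    by (simp only: mult_seq_pair pairs)
  have 4: "(\<forall>i < r - 1. \<exists>\<beta>. \<beta> \<noteq> 0 \<and> as ! (i + 1) = sconj \<sigma> \<delta> (as ! i) \<beta> \<and>
           \<beta> \<notin> {\<sigma> \<gamma> * (as ! i) + \<delta> \<gamma> - (as ! i) * \<gamma> | \<gamma>. True}) \<longleftrightarrow> ?S"
    by (simp only: not_splits_iff_conj[symmetric] pairs)
  have 5: "{p. monic_deg1 p \<and> left_dvd \<sigma> \<delta> p (P_seq \<sigma> \<delta> as)} = {sp_lin (last as)} \<longleftrightarrow> ?S"
    by (simp add: unique_left_factor_iff \<open>as \<noteq> []\<close>)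
  show ?thesis unfolding 1 2 3 4 5 by simp
qed

end
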